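(* Let $\mathcal C$ be a regular (generalized) cluster structure on $\mathbb A^s$ with initial cluster $F=\{f_l\}_{l=1}^s$, $f_1,\dots,f_n$ mutable, and let $\{\cdot,\cdot\}$ be a Poisson bracket on $\mathbb A^s$ such that all $p^*_{mr}$ are Casimirs of $\{\cdot,\cdot\}$, $\{f_m,t_m\}=\omega_mf_mt_m$ with constants $\omega_m\ne0$ for $m\in[1,n]$, and $\{f_l,t_m\}=0$ for $l\ne m$, $l\in[1,s]$, $m\in[1,n]$. Let $\Psi:\mathbb A^r\dashrightarrow\mathbb A^s$ and $\mathtt H=\{\mathtt h_j\}_{j\in J}$ be as in the context, assume that there exists a coherent pullback $\widehat{\mathcal C}$ of $\mathcal C$ to $\mathbb A^r$, and let $\{\cdot,\cdot\}_{\rm p}$ be a Poisson bracket on $\mathbb A^r$ for which $\Psi:(\mathbb A^r,\{\cdot,\cdot\}_{\rm p})\to(\mathbb A^s,\{\cdot,\cdot\})$ is Poisson. Let $\tilde{\mathtt t}_m$ be the $y$-variable at vertex $m$ of the pulled-back quiver $\Psi^*Q$. If all $\mathtt p^*_{mr}$ are Casimirs of $\{\cdot,\cdot\}_{\rm p}$, $\{\mathtt h_j,\tilde{\mathtt t}_m\}_{\rm p}=0$ for all $j\in J$ and $m\in[1,n]$, and the family $\mathtt F\cup\mathtt H$, $\mathtt F=\{\mathtt f_l\}_{l=1}^s$, forms a log-canonical basis for $\{\cdot,\cdot\}_{\rm p}$, then the bracket $\{\cdot,\cdot\}_{\rm p}$ is compatible with $\widehat{\mathcal C}$.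
   Context: All varieties are over $\mathbb C$. Generalized cluster structure. A seed $(Q,\{f_l\}_{l=1}^s,\mathcal P)$ consists of: a quiver with multiplicities $Q=(Q,d_1,\dots,d_n)$ on vertices $1,\dots,s$ without loops and 2-cycles, vertices $1,\dots,n$ mutable with multiplicities $d_m\ge1$, vertices $n+1,\dots,s$ frozen; a cluster $f_1,\dots,f_s$ (algebraically independent generators of the field of rational functions; $f_{n+1},\dots,f_s$ frozen variables); strings $(p_{mr})_{0\le r\le d_m}$ of exchange coefficients depending only on frozen variables, $p_{m0}=p_{md_m}=1$. Let $b_{ml}$ be the number of arrows from $m$ to $l$. The adjacent seed in direction $m\in[1,n]$ replaces $f_m$ by $f_m'$ given by $f_mf_m'=P_m=\sum_{r=0}^{d_m}T_r$, $$T_r=p_{mr}\prod_{l\le n}f_l^{rb_{ml}}\prod_{l>n}f_l^{\lfloor rb_{ml}/d_m\rfloor}\prod_{l\le n}f_l^{(d_m-r)b_{lm}}\prod_{l>n}f_l^{\lfloor(d_m-r)b_{lm}/d_m\rfloor}.$$ Coefficients mutate by $p'_{mr}=p_{m,d_m-r}$, the others unchanged. Quiver mutation at $m$: each path $i\to m\to j$ contributes $d_m$ arrows $i\to j$ if $i,j$ are both mutable, and $d_a$ arrows $i\to j$ if exactly one of $i,j$ is mutable, $a$ being the mutable one; then arrows at $m$ are reversed and 2-cycles deleted; multiplicities do not change. Regular means that all variables in all clusters are regular functions. With $\{a\}=a-\lfloor a\rfloor$ put $$p^*_{mr}=p_{mr}^{d_m}\prod_{n<l\le s}f_l^{-d_m\{rb_{ml}/d_m\}-d_m\{(d_m-r)b_{lm}/d_m\}},\qquad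 t_m=\prod_{l\le n}f_l^{d_m(b_{ml}-b_{lm})}\prod_{l>n}f_l^{b_{ml}-b_{lm}};$$ $t_m$ is the $y$-variable at vertex $m$. One has $(T_r/T_0)^{d_m}=p^*_{mr}t_m^r$. Pullback. Let $r\ge s$ and let $\Psi:\mathbb A^r\dashrightarrow\mathbb A^s$ be a dominant rational map (coordinates $x_1,\dots,x_r$ and $y_1,\dots,y_s$) such that there is a family $\mathtt H=\{\mathtt h_j\}_{j\in J}$ of $r-s$ irreducible algebraically independent polynomials in $\mathbb C[x_1,\dots,x_r]$ with $\Psi^*y_m=\mathtt y_m\prod_{j\in J}\mathtt h_j^{-\kappa_j(y_m)}$, $\mathtt y_m$ a polynomial not divisible by any $\mathtt h_j$, $\kappa_j(y_m)\in\mathbb Z$. For a cluster variable, an exchange coefficient, or a product of such, $f$, write uniquely $\Psi^*f=\mathtt f\prod_{j\in J}\mathtt h_j^{-\lambda_j(f)}$, $\mathtt f$ having no factor $\mathtt h_j$, $\lambda_j(f)\in\mathbb Z$. For an exchange relation $f_mf_m'=P_m$ in any seed, write the pullback of $P_m$ as $\tilde{\mathtt P}_m/\prod_j\mathtt h_j^{\Lambda_j(P_m)}$ with $\tilde{\mathtt P}_m$ a polynomial in (formal variables) $\mathtt f_l$ ($l\ne m$) and $\mathtt h_j$ not divisible by any $\mathtt h_j$. A coherent pullback $\widehat{\mathcal C}$ of $\mathcal C$ exists if for every seed and every $m\in[1,n]$ one has $\prod_j\mathtt h_j^{\lambda_j(f_m)+\lambda_j(f'_m)-\Lambda_j(P_m)}=1$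 and for every seed the family $\{\mathtt f_l\}\cup\mathtt H$ is algebraically independent on $\mathbb A^r$. Then $\widehat{\mathcal C}$ is the almost-cluster structure whose almost-clusters are the families $\{\mathtt f_l\}_{l=1}^s\cup\mathtt H$ over all seeds of $\mathcal C$ ($\mathtt H$ and the $\mathtt f_l$, $l>n$, frozen), with exchange relations $$\mathtt f_m\mathtt f_m'=\sum_{r=0}^{d_m}\mathtt T_r\prod_{j\in J}\mathtt h_j^{\mu_{jm}(r)},\qquad \mu_{jm}(r)=\Lambda_j(P_m)-\lambda_j(T_r).$$ The quiver $\Psi^*Q$ is obtained from $Q$ by adding a frozen vertex for every $j\in J$ (carrying $\mathtt h_j$) and, for $m\in[1,n]$, $|\delta_{jm}|$ arrows between $m$ and $j$, directed from $m$ to $j$ if $\delta_{jm}>0$ and from $j$ to $m$ otherwise, where $$\delta_{jm}=\sum_{l\le n}d_m(b_{lm}-b_{ml})\lambda_j(f_l)+\sum_{n<l\le s}(b_{lm}-b_{ml})\lambda_j(f_l).$$ Thus $\tilde{\mathtt t}_m=\prod_{l\le n}\mathtt f_l^{d_m(b_{ml}-b_{lm})}\prod_{n<l\le s}\mathtt f_l^{b_{ml}-b_{lm}}\prod_{j\in J}\mathtt h_j^{\delta_{jm}}$. The function $\mathtt p^*_{mr}$ is the counterpart of $p^*_{mr}$ for the pulled-back initial seed, i.e. it is defined by $$\left(\frac{\mathtt T_r\prod_j\mathtt h_j^{\mu_{jm}(r)}}{\mathtt T_0\prod_j\mathtt h_j^{\mu_{jm}(0)}}\right)^{d_m}=\mathtt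 p^*_{mr}\,\tilde{\mathtt t}_m^{\,r}.$$ Here $p^*_{mr}$, $t_m$, $\tilde{\mathtt t}_m$, $\mathtt p^*_{mr}$ in the claim refer to the initial seed. A family of functions is a log-canonical basis for a bracket if the bracket of any two members $\varphi,\psi$ equals $\omega\varphi\psi$ with a constant $\omega$ (and the family is a transcendence basis of the field of rational functions). A Poisson bracket is compatible with a (generalized, almost-) cluster structure if $\{\varphi,\psi\}=\omega_{\varphi\psi}\varphi\psi$ with constant $\omega_{\varphi\psi}$ whenever $\varphi,\psi$ belong to the same (almost-)cluster. *)

theory Defs
  imports
    Complex_Main
    "HOL-Library.Cardinality"
    "HOL-Library.Poly_Mapping"
    "HOL-Computational_Algebra.Factorial_Ring"
    "HOL-Computational_Algebra.Fraction_Field"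
begin

section \<open>Polynomials and rational functions on affine space\<close>

text \<open>
  \<open>'v cpoly\<close> is the polynomial ring over the complex numbers with variables indexed by
  \<open>'v\<close>. For a finite type \<open>'v\<close> it is the coordinate ring of affine space of dimension
  \<open>CARD('v)\<close>, and \<open>'v ratfun\<close> is the field of rational functions on that space. (The
  library provides the \<open>idom\<close> instance only for a linearly ordered \<open>'v\<close>; the order
  is not used otherwise.)
\<close>

type_synonym 'v cpoly = "('v \<Rightarrow>\<^sub>0 nat) \<Rightarrow>\<^sub>0 complex"
type_synonym 'v ratfun = "'v cpoly fract"

definition var :: "'v \<Rightarrow> 'v cpoly" where
  "var v = Poly_Mapping.single (Poly_Mapping.single v 1) 1"

definition indets :: "'v cpoly \<Rightarrow> 'v set" where
  "indets p = (\<Union>e\<in>Poly_Mapping.keys p. Poly_Mapping.keys e)"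

definition poly_fun :: "'v::linorder cpoly \<Rightarrow> 'v ratfun" where
  "poly_fun p = Fract p 1"

definition const :: "complex \<Rightarrow> 'v::linorder ratfun" where
  "const c = poly_fun (Poly_Mapping.single 0 c)"

text \<open>The regular functions on affine space are the polynomials.\<close>

definition regular :: "'v::linorder ratfun \<Rightarrow> bool" where
  "regular q \<longleftrightarrow> q \<in> range poly_fun"

definition eval_with :: "(complex \<Rightarrow> 'a::comm_ring_1) \<Rightarrow> ('v \<Rightarrow> 'a) \<Rightarrow> 'v cpoly \<Rightarrow> 'a" where
  "eval_with \<iota> g p =
     (\<Sum>e\<in>Poly_Mapping.keys p. \<iota> (Poly_Mapping.lookup p e)
        * (\<Prod>v\<in>Poly_Mapping.keys e. g v ^ Poly_Mapping.lookup e v))"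

abbreviation value_at :: "('v \<Rightarrow> complex) \<Rightarrow> 'v cpoly \<Rightarrow> complex" where
  "value_at \<equiv> eval_with (\<lambda>c. c)"

abbreviation subst :: "('i \<Rightarrow> 'v::linorder ratfun) \<Rightarrow> 'i cpoly \<Rightarrow> 'v ratfun" where
  "subst \<equiv> eval_with const"

definition alg_indep :: "'i set \<Rightarrow> ('i \<Rightarrow> 'v::linorder ratfun) \<Rightarrow> bool" where
  "alg_indep I g \<longleftrightarrow> (\<forall>p. indets p \<subseteq> I \<and> subst g p = 0 \<longrightarrow> p = 0)"

text \<open>The subfield generated over the complex numbers by the members \<open>g i\<close>, \<open>i \<in> I\<close>.\<close>

definition field_gen :: "'i set \<Rightarrow> ('i \<Rightarrow> 'v::linorder ratfun) \<Rightarrow> 'v ratfun set" where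
  "field_gen I g =
     {subst g a / subst g b |a b. indets a \<subseteq> I \<and> indets b \<subseteq> I \<and> subst g b \<noteq> 0}"

text \<open>A transcendence basis is a maximal algebraically independent family: adjoining any
  rational function \<open>q\<close> (as the member with index \<open>None\<close>) destroys independence.\<close>

definition transcendence_basis :: "'i set \<Rightarrow> ('i \<Rightarrow> 'v::linorder ratfun) \<Rightarrow> bool" where
  "transcendence_basis I g \<longleftrightarrow> alg_indep I g \<and>
     (\<forall>q. \<not> alg_indep (insert None (Some ` I)) (case_option q g))"


section \<open>Rational maps\<close>

text \<open>A rational map from the affine space with coordinates \<open>'r\<close> to the one with
  coordinates \<open>'s\<close> is given by its components \<open>\<Psi> m\<close>, the pullbacks of the coordinate
  functions of the target.\<close>

type_synonym ('r, 's) rational_map = "'s \<Rightarrow> 'r ratfun"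

definition regular_at :: "('v \<Rightarrow> complex) \<Rightarrow> 'v::linorder ratfun \<Rightarrow> bool" where
  "regular_at x q \<longleftrightarrow> (\<exists>a b. q = Fract a b \<and> value_at x b \<noteq> 0)"

definition fun_value :: "('v \<Rightarrow> complex) \<Rightarrow> 'v::linorder ratfun \<Rightarrow> complex" where
  "fun_value x q =
     (THE c. \<exists>a b. q = Fract a b \<and> value_at x b \<noteq> 0 \<and> c = value_at x a / value_at x b)"

definition map_image :: "('r::linorder, 's) rational_map \<Rightarrow> ('s \<Rightarrow> complex) set" where
  "map_image \<Psi> = {(\<lambda>m. fun_value x (\<Psi> m)) |x. \<forall>m. regular_at x (\<Psi> m)}"

text \<open>Dominant: the image is Zariski dense.\<close>

definition dominant :: "('r::linorder, 's) rational_map \<Rightarrow> bool" where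
  "dominant \<Psi> \<longleftrightarrow> (\<forall>p. (\<forall>y\<in>map_image \<Psi>. value_at y p = 0) \<longrightarrow> p = 0)"

text \<open>The value does not depend on the representation \<open>a / b\<close> when \<open>\<Psi>\<close> is dominant.\<close>

definition pullback :: "('r::linorder, 's::linorder) rational_map \<Rightarrow> 's ratfun \<Rightarrow> 'r ratfun" where
  "pullback \<Psi> q = (THE w. \<exists>a b. b \<noteq> 0 \<and> q = Fract a b \<and> w = subst \<Psi> a / subst \<Psi> b)"


section \<open>Poisson brackets\<close>

text \<open>A Poisson bracket on affine space is a Poisson bracket on the coordinate ring. It has a
  unique extension to a Poisson bracket on rational functions, and it is represented by this
  extension; conversely the last condition says that a bracket on rational functions comes
  from the coordinate ring.\<close>

definition poisson_bracket :: "('v::linorder ratfun \<Rightarrow> 'v ratfun \<Rightarrow> 'v ratfun) \<Rightarrow> bool" where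
  "poisson_bracket br \<longleftrightarrow>
     (\<forall>f g k. br (f + g) k = br f k + br g k) \<and>
     (\<forall>c f g. br (const c * f) g = const c * br f g) \<and>
     (\<forall>f g. br f g = - br g f) \<and>
     (\<forall>f g k. br (f * g) k = f * br g k + g * br f k) \<and>
     (\<forall>f g k. br f (br g k) + br g (br k f) + br k (br f g) = 0) \<and>
     (\<forall>f g. regular f \<and> regular g \<longrightarrow> regular (br f g))"

definition casimir :: "('v::linorder ratfun \<Rightarrow> 'v ratfun \<Rightarrow> 'v ratfun) \<Rightarrow> 'v ratfun \<Rightarrow> bool" where
  "casimir br f \<longleftrightarrow> (\<forall>g. br f g = 0)"

definition log_canonical ::
    "('v::linorder ratfun \<Rightarrow> 'v ratfun \<Rightarrow> 'v ratfun) \<Rightarrow> 'i set \<Rightarrow> ('i \<Rightarrow> 'v ratfun) \<Rightarrow> bool" where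
  "log_canonical br I \<phi> \<longleftrightarrow>
     (\<forall>i\<in>I. \<forall>k\<in>I. \<exists>\<omega>. br (\<phi> i) (\<phi> k) = const \<omega> * \<phi> i * \<phi> k)"

definition log_canonical_basis ::
    "('v::linorder ratfun \<Rightarrow> 'v ratfun \<Rightarrow> 'v ratfun) \<Rightarrow> 'i set \<Rightarrow> ('i \<Rightarrow> 'v ratfun) \<Rightarrow> bool" where
  "log_canonical_basis br I \<phi> \<longleftrightarrow> log_canonical br I \<phi> \<and> transcendence_basis I \<phi>"

definition poisson_map ::
    "('r::linorder ratfun \<Rightarrow> 'r ratfun \<Rightarrow> 'r ratfun) \<Rightarrow> ('s::linorder ratfun \<Rightarrow> 's ratfun \<Rightarrow> 's ratfun)
      \<Rightarrow> ('r, 's) rational_map \<Rightarrow> bool" where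
  "poisson_map br_source br_target \<Psi> \<longleftrightarrow>
     (\<forall>f g. pullback \<Psi> (br_target f g) = br_source (pullback \<Psi> f) (pullback \<Psi> g))"


section \<open>Generalized cluster structures\<close>

text \<open>\<open>arrows Q m l\<close> is the number \<open>b\<^sub>m\<^sub>l\<close> of arrows from \<open>m\<close> to \<open>l\<close>. The vertices in
  \<open>verts Q - mutables Q\<close> are frozen; multiplicities are meaningful at mutable vertices only.\<close>

record 'i quiver =
  verts :: "'i set"
  mutables :: "'i set"
  mults :: "'i \<Rightarrow> nat"
  arrows :: "'i \<Rightarrow> 'i \<Rightarrow> nat"

definition frozens :: "'i quiver \<Rightarrow> 'i set" where
  "frozens Q = verts Q - mutables Q"

definition quiver_mutation :: "'i \<Rightarrow> 'i quiver \<Rightarrow> 'i quiver" where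
  "quiver_mutation m Q =
     (let b = arrows Q; d = mults Q; M = mutables Q;
          w = (\<lambda>i j. if i \<in> M \<and> j \<in> M then d m
                     else if i \<in> M then d i
                     else if j \<in> M then d j
                     else 0);
          c = (\<lambda>i j. if i = m \<or> j = m then b j i
                     else b i j + w i j * (b i m * b m j))
      in Q\<lparr>arrows := (\<lambda>i j. c i j - c j i)\<rparr>)"
  \<comment> \<open>The truncated subtraction deletes the 2-cycles.\<close>

definition y_variable :: "'i quiver \<Rightarrow> ('i \<Rightarrow> 'v::linorder ratfun) \<Rightarrow> 'i \<Rightarrow> 'v ratfun" where
  "y_variable Q f m =
     (\<Prod>l\<in>mutables Q. f l powi (int (mults Q m) * (int (arrows Q m l) - int (arrows Q l m))))
     * (\<Prod>l\<in>frozens Q. f l powi (int (arrows Q m l) - int (arrows Q l m)))"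

text \<open>The vertices of a seed on the affine space with coordinates \<open>'s\<close> are the elements of
  the type \<open>'s\<close>, so their number is the dimension.\<close>

record 's seed =
  quiv :: "'s quiver"
  cluster :: "'s \<Rightarrow> 's ratfun"
  coeffs :: "'s \<Rightarrow> nat \<Rightarrow> 's ratfun"

abbreviation smut :: "'s seed \<Rightarrow> 's set" where "smut S \<equiv> mutables (quiv S)"
abbreviation sfroz :: "'s seed \<Rightarrow> 's set" where "sfroz S \<equiv> frozens (quiv S)"
abbreviation sdeg :: "'s seed \<Rightarrow> 's \<Rightarrow> nat" where "sdeg S \<equiv> mults (quiv S)"
abbreviation sarr :: "'s seed \<Rightarrow> 's \<Rightarrow> 's \<Rightarrow> nat" where "sarr S \<equiv> arrows (quiv S)"

definition seed :: "'s::{finite,linorder} seed \<Rightarrow> bool" where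
  "seed S \<longleftrightarrow>
     verts (quiv S) = UNIV \<and>
     (\<forall>i. sarr S i i = 0) \<and>
     (\<forall>i j. sarr S i j = 0 \<or> sarr S j i = 0) \<and>
     (\<forall>m\<in>smut S. sdeg S m \<ge> 1) \<and>
     alg_indep UNIV (cluster S) \<and> field_gen UNIV (cluster S) = UNIV \<and>
     (\<forall>m\<in>smut S. coeffs S m 0 = 1 \<and> coeffs S m (sdeg S m) = 1 \<and>
        (\<forall>r\<le>sdeg S m. coeffs S m r \<in> field_gen (sfroz S) (cluster S)))"

text \<open>The summand \<open>T\<^sub>r\<close> of the exchange polynomial at \<open>m\<close>; \<open>div\<close> renders the floors.\<close>

definition exch_term :: "'s::{finite,linorder} seed \<Rightarrow> 's \<Rightarrow> nat \<Rightarrow> 's ratfun" where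
  "exch_term S m r =
     (let f = cluster S; b = sarr S; d = sdeg S m in
      coeffs S m r
      * (\<Prod>l\<in>smut S. f l ^ (r * b m l))
      * (\<Prod>l\<in>sfroz S. f l ^ ((r * b m l) div d))
      * (\<Prod>l\<in>smut S. f l ^ ((d - r) * b l m))
      * (\<Prod>l\<in>sfroz S. f l ^ (((d - r) * b l m) div d)))"

definition exch_poly :: "'s::{finite,linorder} seed \<Rightarrow> 's \<Rightarrow> 's ratfun" where
  "exch_poly S m = (\<Sum>r\<le>sdeg S m. exch_term S m r)"

definition mutate :: "'s::{finite,linorder} \<Rightarrow> 's seed \<Rightarrow> 's seed" where
  "mutate m S =
     \<lparr>quiv = quiver_mutation m (quiv S),
      cluster = (cluster S)(m := exch_poly S m / cluster S m),
      coeffs = (coeffs S)(m := (\<lambda>r. coeffs S m (sdeg S m - r)))\<rparr>"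

text \<open>The seeds of the generalized cluster structure with a given initial seed.\<close>

inductive_set seeds :: "'s::{finite,linorder} seed \<Rightarrow> 's seed set" for S0 where
  initial: "S0 \<in> seeds S0"
| adjacent: "S \<in> seeds S0 \<Longrightarrow> m \<in> smut S \<Longrightarrow> mutate m S \<in> seeds S0"

definition regular_structure :: "'s::{finite,linorder} seed \<Rightarrow> bool" where
  "regular_structure S0 \<longleftrightarrow> (\<forall>S\<in>seeds S0. \<forall>l. regular (cluster S l))"

text \<open>\<open>p\<^sup>*\<^sub>m\<^sub>r\<close>: here \<open>a mod d\<close> is \<open>d\<close> times the fractional part of \<open>a / d\<close>.\<close>

definition p_star :: "'s::{finite,linorder} seed \<Rightarrow> 's \<Rightarrow> nat \<Rightarrow> 's ratfun" where
  "p_star S m r =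
     (let b = sarr S; d = sdeg S m in
      coeffs S m r ^ d
      * (\<Prod>l\<in>sfroz S. cluster S l powi
            (- int ((r * b m l) mod d) - int (((d - r) * b l m) mod d))))"

abbreviation t_var :: "'s::{finite,linorder} seed \<Rightarrow> 's \<Rightarrow> 's ratfun" where
  "t_var S \<equiv> y_variable (quiv S) (cluster S)"


section \<open>Coherent pullbacks\<close>

abbreviation hmonom :: "'j set \<Rightarrow> ('j \<Rightarrow> 'r::linorder cpoly) \<Rightarrow> ('j \<Rightarrow> int) \<Rightarrow> 'r ratfun" where
  "hmonom J h e \<equiv> (\<Prod>j\<in>J. poly_fun (h j) powi e j)"

definition pullback_family ::
    "('r::{finite,linorder}, 's::{finite,linorder}) rational_map \<Rightarrow> 'j set \<Rightarrow> ('j \<Rightarrow> 'r cpoly) \<Rightarrow> bool" where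
  "pullback_family \<Psi> J h \<longleftrightarrow>
     CARD('s) \<le> CARD('r) \<and> finite J \<and> card J = CARD('r) - CARD('s) \<and>
     (\<forall>j\<in>J. irreducible (h j)) \<and> alg_indep J (\<lambda>j. poly_fun (h j)) \<and>
     (\<forall>m. \<exists>y (\<kappa> :: 'j \<Rightarrow> int). (\<forall>j\<in>J. \<not> h j dvd y) \<and>
        \<Psi> m = poly_fun y * hmonom J h (\<lambda>j. - \<kappa> j))"

text \<open>\<open>no_factor J h q\<close>: no \<open>h j\<close> occurs in \<open>q\<close>, neither in the numerator nor in the
  denominator.\<close>

definition no_factor :: "'j set \<Rightarrow> ('j \<Rightarrow> 'r::linorder cpoly) \<Rightarrow> 'r ratfun \<Rightarrow> bool" where
  "no_factor J h q \<longleftrightarrow> (\<exists>a b. q = Fract a b \<and> (\<forall>j\<in>J. \<not> h j dvd a \<and> \<not> h j dvd b) \<and> b \<noteq> 0)"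

text \<open>The exponents \<open>\<lambda>\<^sub>j(f)\<close> and the function with pullback of \<open>f\<close> equal to
  \<open>stripped f * (\<Prod>j\<in>J. h\<^sub>j powi (- \<lambda>\<^sub>j(f)))\<close>. The exponents are unique for \<open>f \<noteq> 0\<close>;
  for \<open>f = 0\<close> (a vanishing exchange coefficient) the stripped function is \<open>0\<close> and the value of
  the exponents is immaterial.\<close>

definition hexp ::
    "('r::linorder, 's::linorder) rational_map \<Rightarrow> 'j set \<Rightarrow> ('j \<Rightarrow> 'r cpoly) \<Rightarrow> 's ratfun \<Rightarrow> 'j \<Rightarrow> int" where
  "hexp \<Psi> J h f =
     (SOME e. \<exists>q. no_factor J h q \<and> pullback \<Psi> f = q * hmonom J h (\<lambda>j. - e j))"

definition stripped ::
    "('r::linorder, 's::linorder) rational_map \<Rightarrow> 'j set \<Rightarrow> ('j \<Rightarrow> 'r cpoly) \<Rightarrow> 's ratfun \<Rightarrow> 'r ratfun" where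
  "stripped \<Psi> J h f = pullback \<Psi> f * hmonom J h (hexp \<Psi> J h f)"

text \<open>The members of an almost-cluster: the \<open>Inl\<close> indices carry the stripped cluster
  variables, the \<open>Inr\<close> indices in \<open>J\<close> the additional frozen variables.\<close>

definition almost_cluster ::
    "('r::linorder, 's::linorder) rational_map \<Rightarrow> 'j set \<Rightarrow> ('j \<Rightarrow> 'r cpoly) \<Rightarrow> 's seed \<Rightarrow> 's + 'j \<Rightarrow> 'r ratfun" where
  "almost_cluster \<Psi> J h S =
     case_sum (\<lambda>l. stripped \<Psi> J h (cluster S l)) (\<lambda>j. poly_fun (h j))"

definition almost_verts :: "'j set \<Rightarrow> ('s + 'j) set" where
  "almost_verts J = range Inl \<union> Inr ` J"

text \<open>The pulled back exchange polynomial at \<open>m\<close> is written as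
  \<open>p / (\<Prod>j. h\<^sub>j powi \<Lambda>\<^sub>j)\<close> with \<open>p\<close> a formal polynomial in the members of the
  almost-cluster other than the one at \<open>m\<close>, divisible by none of the variables that stand for
  the \<open>h\<^sub>j\<close>. By algebraic independence of the almost-cluster, \<open>\<Lambda>\<close> is unique on \<open>J\<close>.\<close>

definition is_denominator ::
    "('r::{finite,linorder}, 's::{finite,linorder}) rational_map \<Rightarrow> 'j set \<Rightarrow> ('j \<Rightarrow> 'r cpoly)
      \<Rightarrow> 's seed \<Rightarrow> 's \<Rightarrow> ('j \<Rightarrow> int) \<Rightarrow> bool" where
  "is_denominator \<Psi> J h S m \<Lambda> \<longleftrightarrow>
     (\<exists>p :: ('s + 'j) cpoly. indets p \<subseteq> almost_verts J - {Inl m} \<and>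
        (\<forall>j\<in>J. \<not> var (Inr j) dvd p) \<and>
        pullback \<Psi> (exch_poly S m) = subst (almost_cluster \<Psi> J h S) p / hmonom J h \<Lambda>)"

definition denom_exp ::
    "('r::{finite,linorder}, 's::{finite,linorder}) rational_map \<Rightarrow> 'j set \<Rightarrow> ('j \<Rightarrow> 'r cpoly)
      \<Rightarrow> 's seed \<Rightarrow> 's \<Rightarrow> 'j \<Rightarrow> int" where
  "denom_exp \<Psi> J h S m = (SOME \<Lambda>. is_denominator \<Psi> J h S m \<Lambda>)"

definition coherent_pullback_exists ::
    "('r::{finite,linorder}, 's::{finite,linorder}) rational_map \<Rightarrow> 'j set \<Rightarrow> ('j \<Rightarrow> 'r cpoly)
      \<Rightarrow> 's seed \<Rightarrow> bool" where
  "coherent_pullback_exists \<Psi> J h S0 \<longleftrightarrow>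
     (\<forall>S\<in>seeds S0.
        alg_indep (almost_verts J) (almost_cluster \<Psi> J h S) \<and>
        (\<forall>m\<in>smut S.
           (\<exists>\<Lambda>. is_denominator \<Psi> J h S m \<Lambda>) \<and>
           hmonom J h (\<lambda>j. hexp \<Psi> J h (cluster S m) j + hexp \<Psi> J h (cluster (mutate m S) m) j
                           - denom_exp \<Psi> J h S m j) = 1))"

definition delta ::
    "('r::linorder, 's::linorder) rational_map \<Rightarrow> 'j set \<Rightarrow> ('j \<Rightarrow> 'r cpoly) \<Rightarrow> 's seed \<Rightarrow> 'j \<Rightarrow> 's \<Rightarrow> int" where
  "delta \<Psi> J h S j m =
     (\<Sum>l\<in>smut S. int (sdeg S m) * (int (sarr S l m) - int (sarr S m l)) * hexp \<Psi> J h (cluster S l) j)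
     + (\<Sum>l\<in>sfroz S. (int (sarr S l m) - int (sarr S m l)) * hexp \<Psi> J h (cluster S l) j)"

fun pullback_arrows ::
    "('r::linorder, 's::linorder) rational_map \<Rightarrow> 'j set \<Rightarrow> ('j \<Rightarrow> 'r cpoly) \<Rightarrow> 's seed
      \<Rightarrow> 's + 'j \<Rightarrow> 's + 'j \<Rightarrow> nat" where
  "pullback_arrows \<Psi> J h S (Inl i) (Inl k) = sarr S i k"
| "pullback_arrows \<Psi> J h S (Inl m) (Inr j) =
     (if m \<in> smut S \<and> j \<in> J then nat (delta \<Psi> J h S j m) else 0)"
| "pullback_arrows \<Psi> J h S (Inr j) (Inl m) =
     (if m \<in> smut S \<and> j \<in> J then nat (- delta \<Psi> J h S j m) else 0)"
| "pullback_arrows \<Psi> J h S (Inr j) (Inr k) = 0"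

definition pullback_quiver ::
    "('r::linorder, 's::linorder) rational_map \<Rightarrow> 'j set \<Rightarrow> ('j \<Rightarrow> 'r cpoly) \<Rightarrow> 's seed \<Rightarrow> ('s + 'j) quiver" where
  "pullback_quiver \<Psi> J h S =
     \<lparr>verts = almost_verts J, mutables = Inl ` smut S,
      mults = case_sum (sdeg S) (\<lambda>_. 1), arrows = pullback_arrows \<Psi> J h S\<rparr>"

text \<open>The \<open>r\<close>-th summand of the exchange relation at \<open>m\<close> in the almost-cluster structure; the
  exponent of \<open>h\<^sub>j\<close> is \<open>\<mu>\<^sub>j\<^sub>m(r)\<close>.\<close>

definition almost_exch_term ::
    "('r::{finite,linorder}, 's::{finite,linorder}) rational_map \<Rightarrow> 'j set \<Rightarrow> ('j \<Rightarrow> 'r cpoly)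
      \<Rightarrow> 's seed \<Rightarrow> 's \<Rightarrow> nat \<Rightarrow> 'r ratfun" where
  "almost_exch_term \<Psi> J h S m r =
     stripped \<Psi> J h (exch_term S m r)
     * hmonom J h (\<lambda>j. denom_exp \<Psi> J h S m j - hexp \<Psi> J h (exch_term S m r) j)"

record ('s, 'j, 'r) almost_seed =
  aquiv :: "('s + 'j) quiver"
  aclus :: "'s + 'j \<Rightarrow> 'r ratfun"
  aterm :: "'s \<Rightarrow> nat \<Rightarrow> 'r ratfun"

definition pullback_seed ::
    "('r::{finite,linorder}, 's::{finite,linorder}) rational_map \<Rightarrow> 'j set \<Rightarrow> ('j \<Rightarrow> 'r cpoly)
      \<Rightarrow> 's seed \<Rightarrow> ('s, 'j, 'r) almost_seed" where
  "pullback_seed \<Psi> J h S =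
     \<lparr>aquiv = pullback_quiver \<Psi> J h S, aclus = almost_cluster \<Psi> J h S,
      aterm = almost_exch_term \<Psi> J h S\<rparr>"

definition almost_t_var :: "('s, 'j, 'r::linorder) almost_seed \<Rightarrow> 's \<Rightarrow> 'r ratfun" where
  "almost_t_var A m = y_variable (aquiv A) (aclus A) (Inl m)"

text \<open>The solution \<open>p\<close> of \<open>(aterm A m r / aterm A m 0) ^ d = p * (almost_t_var A m) ^ r\<close>.\<close>

definition almost_p_star :: "('s, 'j, 'r::linorder) almost_seed \<Rightarrow> 's \<Rightarrow> nat \<Rightarrow> 'r ratfun" where
  "almost_p_star A m r =
     (aterm A m r / aterm A m 0) ^ mults (aquiv A) (Inl m) / almost_t_var A m ^ r"

text \<open>The pullback of the structure with initial seed \<open>S0\<close>, as its set of almost-seeds.\<close>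

definition pullback_structure ::
    "('r::{finite,linorder}, 's::{finite,linorder}) rational_map \<Rightarrow> 'j set \<Rightarrow> ('j \<Rightarrow> 'r cpoly)
      \<Rightarrow> 's seed \<Rightarrow> ('s, 'j, 'r) almost_seed set" where
  "pullback_structure \<Psi> J h S0 = pullback_seed \<Psi> J h ` seeds S0"

definition compatible ::
    "('r::linorder ratfun \<Rightarrow> 'r ratfun \<Rightarrow> 'r ratfun) \<Rightarrow> ('s, 'j, 'r) almost_seed set \<Rightarrow> bool" where
  "compatible br C \<longleftrightarrow> (\<forall>A\<in>C. log_canonical br (verts (aquiv A)) (aclus A))"

end

theory Submission
  imports Defs
begin

text \<open>
  Write \<open>\<phi> = \<Psi>\<^sup>*\<close>, a homomorphism of fields since \<open>\<Psi>\<close> is dominant. The exponents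
  \<open>\<delta>\<^sub>j\<^sub>m\<close> are chosen such that the \<open>y\<close>-variable of the pulled back quiver is \<open>\<phi> t\<^sub>m\<close>; likewise
  the pulled back \<open>p\<^sup>*\<^sub>m\<^sub>r\<close> is \<open>\<phi> p\<^sup>*\<^sub>m\<^sub>r\<close>. With the logarithmic bracket
  \<open>lb f g = {f, g} / (f g)\<close>, which is additive on products, \<open>(T\<^sub>r / T\<^sub>0) ^ d = p\<^sup>*\<^sub>m\<^sub>r * t\<^sub>m ^ r\<close>
  and the Casimir property yield \<open>lb (\<phi> (P\<^sub>m / T\<^sub>0)) x = \<epsilon> * lb (\<phi> t\<^sub>m) x\<close> for all \<open>x\<close>, with one
  and the same \<open>\<epsilon>\<close>. Hence \<open>P\<^sub>m / T\<^sub>0\<close> commutes with the \<open>h\<^sub>j\<close> and with the \<open>\<phi> f\<^sub>l\<close>, \<open>l \<noteq> m\<close>, and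
  \<open>f'\<^sub>m = P\<^sub>m / f\<^sub>m\<close> behaves towards them like the monomial \<open>T\<^sub>0 / f\<^sub>m\<close>.
  All hypotheses on the initial seed pass to the adjacent seeds: the \<open>p\<^sup>*\<close> are permuted,
  \<open>t'\<^sub>m = 1 / t\<^sub>m\<close>, and \<open>t'\<^sub>k / t\<^sub>k\<close> is a product of powers of \<open>P\<^sub>m / T\<^sub>0\<close> and \<open>P\<^sub>m / T\<^sub>d\<close>. The only
  relation that needs an additional argument is \<open>{f'\<^sub>m, t'\<^sub>k} = 0\<close>; it follows from the two ways
  to evaluate \<open>{t\<^sub>m, t\<^sub>k}\<close>.
\<close>

section \<open>Evaluation of polynomials\<close>

lemma poly_mapping_induct_add [case_names zero add]:
  fixes p :: "'a \<Rightarrow>\<^sub>0 'b::monoid_add"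
  assumes "P 0" and "\<And>p e c. P p \<Longrightarrow> P (p + Poly_Mapping.single e c)"
  shows "P p"
proof (induction p rule: update_induct)
  case const
  show ?case by (fact assms(1))
next
  case (update f a b)
  have "Poly_Mapping.update a b f = f + Poly_Mapping.single a b"
    using update(1)
    by (intro poly_mapping_eqI) (auto simp: lookup_update lookup_add lookup_single in_keys_iff when_def)
  then show ?case using assms(2)[OF update(3)] by simp
qed

lemma var_neq_0: "var i \<noteq> 0"
  by (simp add: var_def flip: keys_eq_empty)

text \<open>Covers both uses of \<open>eval_with\<close>: values at points (identity on
  coefficients) and substitution of rational functions (coefficients embedded by
  \<open>const\<close>).\<close>

locale coefficient_hom =
  fixes \<iota> :: "complex \<Rightarrow> 'a::comm_ring_1"
  assumes hom_0: "\<iota> 0 = 0" and hom_1: "\<iota> 1 = 1"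
    and hom_add: "\<iota> (a + b) = \<iota> a + \<iota> b" and hom_mult: "\<iota> (a * b) = \<iota> a * \<iota> b"
begin

definition monomial_value :: "('v \<Rightarrow> 'a) \<Rightarrow> ('v \<Rightarrow>\<^sub>0 nat) \<Rightarrow> 'a" where
  "monomial_value g e = (\<Prod>v\<in>Poly_Mapping.keys e. g v ^ Poly_Mapping.lookup e v)"

lemma monomial_value_superset:
  assumes "finite A" "Poly_Mapping.keys e \<subseteq> A"
  shows "monomial_value g e = (\<Prod>v\<in>A. g v ^ Poly_Mapping.lookup e v)"
  unfolding monomial_value_def
  using assms by (intro prod.mono_neutral_left) (auto simp: in_keys_iff)

lemma monomial_value_add: "monomial_value g (d + e) = monomial_value g d * monomial_value g e"
proof -
  let ?A = "Poly_Mapping.keys d \<union> Poly_Mapping.keys e"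
  have "monomial_value g (d + e) = (\<Prod>v\<in>?A. g v ^ Poly_Mapping.lookup (d + e) v)"
    by (rule monomial_value_superset) (use keys_add[of d e] in auto)
  also have "\<dots> = (\<Prod>v\<in>?A. g v ^ Poly_Mapping.lookup d v) * (\<Prod>v\<in>?A. g v ^ Poly_Mapping.lookup e v)"
    by (simp add: lookup_add power_add prod.distrib)
  also have "\<dots> = monomial_value g d * monomial_value g e"
    by (simp add: monomial_value_superset[of ?A])
  finally show ?thesis .
qed

lemma eval_with_superset:
  assumes "finite A" "Poly_Mapping.keys p \<subseteq> A"
  shows "eval_with \<iota> g p = (\<Sum>e\<in>A. \<iota> (Poly_Mapping.lookup p e) * monomial_value g e)"
  unfolding eval_with_def monomial_value_def
  using assms by (intro sum.mono_neutral_left) (auto simp: in_keys_iff hom_0)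

lemma eval_with_0 [simp]: "eval_with \<iota> g 0 = 0"
  by (simp add: eval_with_def)

lemma eval_with_single:
  "eval_with \<iota> g (Poly_Mapping.single e c) = \<iota> c * monomial_value g e"
  by (subst eval_with_superset[of "{e}"]) (auto simp: hom_0)

lemma eval_with_1 [simp]: "eval_with \<iota> g 1 = 1"
  unfolding single_one[symmetric] eval_with_single by (simp add: monomial_value_def hom_1)

lemma eval_with_var [simp]: "eval_with \<iota> g (var v) = g v"
  by (simp add: var_def eval_with_single monomial_value_def hom_1)

lemma eval_with_add: "eval_with \<iota> g (p + q) = eval_with \<iota> g p + eval_with \<iota> g q"
proof -
  let ?A = "Poly_Mapping.keys p \<union> Poly_Mapping.keys q"
  have "eval_with \<iota> g (p + q) = (\<Sum>e\<in>?A. \<iota> (Poly_Mapping.lookup (p + q) e) * monomial_value g e)"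
    by (rule eval_with_superset) (use keys_add[of p q] in auto)
  also have "\<dots> = (\<Sum>e\<in>?A. \<iota> (Poly_Mapping.lookup p e) * monomial_value g e)
      + (\<Sum>e\<in>?A. \<iota> (Poly_Mapping.lookup q e) * monomial_value g e)"
    by (simp add: lookup_add hom_add distrib_right sum.distrib)
  also have "\<dots> = eval_with \<iota> g p + eval_with \<iota> g q"
    by (simp add: eval_with_superset[of ?A])
  finally show ?thesis .
qed

lemma eval_with_mult: "eval_with \<iota> g (p * q) = eval_with \<iota> g p * eval_with \<iota> g q"
proof (induction p rule: poly_mapping_induct_add)
  case zero
  show ?case by simp
next
  case (add p e c)
  have "eval_with \<iota> g (Poly_Mapping.single e c * q)
      = eval_with \<iota> g (Poly_Mapping.single e c) * eval_with \<iota> g q"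
  proof (induction q rule: poly_mapping_induct_add)
    case zero
    show ?case by simp
  next
    case (add q e' c')
    then show ?case
      by (simp add: distrib_left eval_with_add mult_single eval_with_single hom_mult
          monomial_value_add mult_ac)
  qed
  with add show ?case by (simp add: distrib_right eval_with_add)
qed

end

interpretation complex_id: coefficient_hom "\<lambda>c. c"
  by unfold_locales auto

lemma const_alt: "const c = Fract (Poly_Mapping.single 0 c) 1"
  by (simp add: const_def poly_fun_def)

interpretation const: coefficient_hom const
  by unfold_locales
    (simp_all add: const_alt Zero_fract_def One_fract_def single_add mult_single)

lemma fract_of_nat_eq_0_iff: "of_nat n = (0 :: 'v::linorder ratfun) \<longleftrightarrow> n = 0"
  by (simp only: of_nat_fract Zero_fract_def) (simp add: eq_fract)

lemma const_minus: "const (- c) = - const c"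
  using const.hom_add[of "- c" c] by (simp add: const.hom_0 add_eq_0_iff2)

lemma alg_indep_neq_0:
  assumes "alg_indep I g" "i \<in> I"
  shows "g i \<noteq> 0"
proof
  assume "g i = 0"
  then have "subst g (var i) = 0" by simp
  moreover have "indets (var i :: 'a cpoly) \<subseteq> I"
    using assms(2) by (auto simp: indets_def var_def split: if_splits)
  ultimately show False using assms(1) var_neq_0[of i] unfolding alg_indep_def by blast
qed


section \<open>Pullback along a dominant map\<close>

definition has_value :: "('v \<Rightarrow> complex) \<Rightarrow> 'v::linorder ratfun \<Rightarrow> complex \<Rightarrow> bool" where
  "has_value x q c \<longleftrightarrow>
     (\<exists>a b. q = Fract a b \<and> value_at x b \<noteq> 0 \<and> c = value_at x a / value_at x b)"

text \<open>Equal fractions can be cross-multiplied and evaluated at \<open>x\<close>, where neither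
  denominator vanishes. This justifies the description in \<open>fun_value\<close>.\<close>

lemma has_value_unique:
  assumes "has_value x q c" "has_value x q c'"
  shows "c = c'"
proof -
  obtain a b where ab: "q = Fract a b" "value_at x b \<noteq> 0" "c = value_at x a / value_at x b"
    using assms(1) by (auto simp: has_value_def)
  obtain a' b' where ab': "q = Fract a' b'" "value_at x b' \<noteq> 0" "c' = value_at x a' / value_at x b'"
    using assms(2) by (auto simp: has_value_def)
  have "b \<noteq> 0" "b' \<noteq> 0" using ab(2) ab'(2) by auto
  then have "a * b' = a' * b" using ab(1) ab'(1) by (simp add: eq_fract)
  then have "value_at x a * value_at x b' = value_at x a' * value_at x b"
    by (metis complex_id.eval_with_mult)
  then show ?thesis using ab ab' by (simp add: frac_eq_eq)
qed

lemma has_value_fun_value: "regular_at x q \<Longrightarrow> has_value x q (fun_value x q)"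
  unfolding fun_value_def has_value_def[symmetric]
  by (rule theI') (metis has_value_def has_value_unique regular_at_def)

lemma has_value_const: "has_value x (const c) c"
  unfolding has_value_def const_alt
  by (rule exI[of _ "Poly_Mapping.single 0 c"], rule exI[of _ 1])
    (simp add: complex_id.eval_with_single complex_id.monomial_value_def)

lemma has_value_add:
  assumes "has_value x q c" "has_value x q' c'"
  shows "has_value x (q + q') (c + c')"
proof -
  obtain a b where ab: "q = Fract a b" "value_at x b \<noteq> 0" "c = value_at x a / value_at x b"
    using assms(1) by (auto simp: has_value_def)
  obtain a' b' where ab': "q' = Fract a' b'" "value_at x b' \<noteq> 0" "c' = value_at x a' / value_at x b'"
    using assms(2) by (auto simp: has_value_def)
  have "b \<noteq> 0" "b' \<noteq> 0" using ab(2) ab'(2) by auto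
  then have "q + q' = Fract (a * b' + a' * b) (b * b')" by (simp add: ab ab')
  moreover have "value_at x (b * b') \<noteq> 0" using ab(2) ab'(2) by (simp add: complex_id.eval_with_mult)
  moreover have "c + c' = value_at x (a * b' + a' * b) / value_at x (b * b')"
    using ab(2,3) ab'(2,3)
    by (simp add: complex_id.eval_with_add complex_id.eval_with_mult add_frac_eq)
  ultimately show ?thesis unfolding has_value_def by blast
qed

lemma has_value_mult:
  assumes "has_value x q c" "has_value x q' c'"
  shows "has_value x (q * q') (c * c')"
proof -
  obtain a b where ab: "q = Fract a b" "value_at x b \<noteq> 0" "c = value_at x a / value_at x b"
    using assms(1) by (auto simp: has_value_def)
  obtain a' b' where ab': "q' = Fract a' b'" "value_at x b' \<noteq> 0" "c' = value_at x a' / value_at x b'"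
    using assms(2) by (auto simp: has_value_def)
  show ?thesis unfolding has_value_def
    by (intro exI[of _ "a * a'"] exI[of _ "b * b'"])
      (use ab ab' in \<open>simp add: complex_id.eval_with_mult\<close>)
qed

lemma has_value_power: "has_value x q c \<Longrightarrow> has_value x (q ^ n) (c ^ n)"
  by (induction n) (use has_value_const[of x 1] in \<open>simp_all add: const.hom_1 has_value_mult\<close>)

lemma has_value_prod:
  "(\<And>i. i \<in> A \<Longrightarrow> has_value x (q i) (c i)) \<Longrightarrow> has_value x (prod q A) (prod c A)"
  by (induction A rule: infinite_finite_induct)
    (use has_value_const[of x 1] in \<open>simp_all add: const.hom_1 has_value_mult\<close>)

lemma has_value_sum:
  "(\<And>i. i \<in> A \<Longrightarrow> has_value x (q i) (c i)) \<Longrightarrow> has_value x (sum q A) (sum c A)"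
  by (induction A rule: infinite_finite_induct)
    (use has_value_const[of x 0] in \<open>simp_all add: const.hom_0 has_value_add\<close>)

lemma has_value_subst:
  assumes "\<And>m. has_value x (\<Psi> m) (y m)"
  shows "has_value x (subst \<Psi> p) (value_at y p)"
  unfolding eval_with_def
  by (intro has_value_sum has_value_mult has_value_const has_value_prod has_value_power assms)

text \<open>The value of \<open>subst \<Psi> p\<close> at a point is the value of \<open>p\<close>
  at the image point, so \<open>p\<close> vanishes on the Zariski dense image.\<close>

lemma dominant_subst_eq_0:
  assumes "dominant \<Psi>" "subst \<Psi> p = 0"
  shows "p = 0"
proof -
  have "value_at y p = 0" if y: "y \<in> map_image \<Psi>" for y
  proof -
    obtain x where x: "y = (\<lambda>m. fun_value x (\<Psi> m))" "\<forall>m. regular_at x (\<Psi> m)"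
      using y unfolding map_image_def by blast
    then have "has_value x (subst \<Psi> p) (value_at y p)"
      by (intro has_value_subst) (simp add: has_value_fun_value)
    with assms(2) has_value_const[of x 0] show ?thesis
      by (auto simp: const.hom_0 intro: has_value_unique)
  qed
  with assms(1) show ?thesis unfolding dominant_def by blast
qed

section \<open>Homomorphisms of fields\<close>

locale field_hom =
  fixes \<phi> :: "'a::field \<Rightarrow> 'b::field"
  assumes hom_1 [simp]: "\<phi> 1 = 1"
    and hom_add: "\<phi> (a + b) = \<phi> a + \<phi> b" and hom_mult: "\<phi> (a * b) = \<phi> a * \<phi> b"
begin

lemma hom_0 [simp]: "\<phi> 0 = 0"
proof -
  have "\<phi> 0 + \<phi> 0 = \<phi> 0 + 0" using hom_add[of 0 0] by simp
  then show ?thesis by (simp only: add_left_cancel)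
qed

lemma hom_eq_0_iff [simp]: "\<phi> a = 0 \<longleftrightarrow> a = 0"
proof
  assume "\<phi> a = 0"
  show "a = 0"
  proof (rule ccontr)
    assume "a \<noteq> 0"
    then have "\<phi> a * \<phi> (inverse a) = 1" by (simp flip: hom_mult)
    with \<open>\<phi> a = 0\<close> show False by simp
  qed
qed simp

lemma hom_inverse: "\<phi> (inverse a) = inverse (\<phi> a)"
proof (cases "a = 0")
  case False
  then have "\<phi> a * \<phi> (inverse a) = 1" by (simp flip: hom_mult)
  then show ?thesis by (metis inverse_unique)
qed simp

lemma hom_divide: "\<phi> (a / b) = \<phi> a / \<phi> b"
  by (simp add: divide_inverse hom_mult hom_inverse)

lemma hom_power: "\<phi> (a ^ n) = \<phi> a ^ n"
  by (induction n) (simp_all add: hom_mult)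

lemma hom_powi: "\<phi> (a powi n) = \<phi> a powi n"
  by (cases n rule: int_cases2) (simp_all add: hom_power power_int_minus hom_inverse)

lemma hom_prod: "\<phi> (prod f A) = (\<Prod>i\<in>A. \<phi> (f i))"
  by (induction A rule: infinite_finite_induct) (simp_all add: hom_mult)

lemma hom_sum: "\<phi> (sum f A) = (\<Sum>i\<in>A. \<phi> (f i))"
  by (induction A rule: infinite_finite_induct) (simp_all add: hom_add)

end

text \<open>Injectivity of the substitution keeps denominators nonzero, so cross-multiplication
  shows independence of the chosen fraction.\<close>

lemma pullback_Fract:
  assumes "dominant \<Psi>" "b \<noteq> 0"
  shows "pullback \<Psi> (Fract a b) = subst \<Psi> a / subst \<Psi> b"
  unfolding pullback_def
proof (rule the_equality)
  show "\<exists>a' b'. b' \<noteq> 0 \<and> Fract a b = Fract a' b' \<and> subst \<Psi> a / subst \<Psi> b = subst \<Psi> a' / subst \<Psi> b'"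
    using assms(2) by blast
next
  fix w
  assume "\<exists>a' b'. b' \<noteq> 0 \<and> Fract a b = Fract a' b' \<and> w = subst \<Psi> a' / subst \<Psi> b'"
  then obtain a' b' where *: "b' \<noteq> 0" "Fract a b = Fract a' b'" "w = subst \<Psi> a' / subst \<Psi> b'"
    by blast
  then have "a * b' = a' * b" using assms(2) by (simp add: eq_fract)
  then have "subst \<Psi> a * subst \<Psi> b' = subst \<Psi> a' * subst \<Psi> b"
    by (metis const.eval_with_mult)
  moreover have "subst \<Psi> b \<noteq> 0" "subst \<Psi> b' \<noteq> 0"
    using dominant_subst_eq_0[OF assms(1)] assms(2) * by blast+
  ultimately show "w = subst \<Psi> a / subst \<Psi> b" using * by (simp add: frac_eq_eq)
qed

lemma field_hom_pullback:
  fixes \<Psi> :: "('r::linorder, 's::linorder) rational_map"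
  assumes "dominant \<Psi>"
  shows "field_hom (pullback \<Psi>)"
proof
  note nz = dominant_subst_eq_0[OF assms]
  show "pullback \<Psi> 1 = 1"
    unfolding One_fract_def pullback_Fract[OF assms one_neq_zero] by (simp flip: One_fract_def)
  fix p q :: "'s ratfun"
  obtain a b where ab: "p = Fract a b" "b \<noteq> 0" by (cases p)
  obtain c d where cd: "q = Fract c d" "d \<noteq> 0" by (cases q)
  have "subst \<Psi> b \<noteq> 0" "subst \<Psi> d \<noteq> 0" using nz ab cd by blast+
  with ab cd show "pullback \<Psi> (p + q) = pullback \<Psi> p + pullback \<Psi> q"
    "pullback \<Psi> (p * q) = pullback \<Psi> p * pullback \<Psi> q"
    by (simp_all add: pullback_Fract[OF assms] const.eval_with_add const.eval_with_mult
        add_frac_eq)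
qed


section \<open>Logarithmic brackets\<close>

locale biderivation =
  fixes br :: "'a::field \<Rightarrow> 'a \<Rightarrow> 'a"
  assumes br_add: "br (f + g) k = br f k + br g k"
    and br_skew: "br f g = - br g f"
    and br_mult: "br (f * g) k = f * br g k + g * br f k"
    and char_0: "of_nat n = (0 :: 'a) \<Longrightarrow> n = 0"
begin

lemma of_int_eq_0_iff [simp]: "of_int i = (0 :: 'a) \<longleftrightarrow> i = 0"
  using char_0 by (cases i rule: int_cases2) (auto simp: neg_eq_iff_add_eq_0)

lemma of_nat_eq_0_iff [simp]: "of_nat n = (0 :: 'a) \<longleftrightarrow> n = 0"
  using char_0 by auto

lemma br_0 [simp]: "br 0 k = 0"
proof -
  have "br 0 k + br 0 k = br 0 k + 0" using br_add[of 0 0 k] by simp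
  then show ?thesis by (simp only: add_left_cancel)
qed

lemma br_0_right [simp]: "br k 0 = 0"
  using br_skew[of k 0] by simp

lemma br_1 [simp]: "br 1 k = 0"
proof -
  have "br 1 k + br 1 k = br 1 k + 0" using br_mult[of 1 1 k] by simp
  then show ?thesis by (simp only: add_left_cancel)
qed

lemma br_sum: "br (sum f A) k = (\<Sum>i\<in>A. br (f i) k)"
  by (induction A rule: infinite_finite_induct) (simp_all add: br_add)

lemma br_self: "br f f = 0"
proof -
  \<comment> \<open>Written with \<open>of_int 2\<close> so that characteristic zero, in the form
    \<open>of_int_eq_0_iff\<close>, cancels the factor.\<close>
  have "of_int 2 * br f f = 0" using br_skew[of f f] by (metis add.right_inverse mult_2 of_int_numeral)
  then show ?thesis unfolding mult_eq_0_iff by (simp del: of_int_numeral)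
qed

text \<open>Division by zero gives 0 when an argument vanishes; the bracket vanishes there as well,
  so \<open>br_eq_lb\<close> holds without side conditions.\<close>

definition lb :: "'a \<Rightarrow> 'a \<Rightarrow> 'a" where
  "lb f g = br f g / (f * g)"

lemma lb_0 [simp]: "lb 0 g = 0" "lb f 0 = 0"
  by (simp_all add: lb_def)

lemma lb_1 [simp]: "lb 1 g = 0"
  by (simp add: lb_def)

lemma lb_self [simp]: "lb f f = 0"
  by (simp add: lb_def br_self)

lemma lb_skew: "lb f g = - lb g f"
  using br_skew[of f g] by (simp add: lb_def mult.commute)

lemma br_eq_lb: "br f g = lb f g * f * g"
  by (cases "f = 0 \<or> g = 0") (auto simp: lb_def)

lemma lb_mult:
  assumes "f \<noteq> 0" "g \<noteq> 0"
  shows "lb (f * g) k = lb f k + lb g k"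
  using assms by (cases "k = 0") (simp_all add: lb_def br_mult field_simps)

lemma lb_inverse: "lb (inverse f) k = - lb f k"
proof (cases "f = 0")
  case False
  then show ?thesis using lb_mult[of "inverse f" f k] by (simp add: add_eq_0_iff2)
qed simp

lemma lb_divide:
  assumes "f \<noteq> 0" "g \<noteq> 0"
  shows "lb (f / g) k = lb f k - lb g k"
  using assms lb_mult[of f "inverse g" k] by (simp add: divide_inverse lb_inverse)

lemma lb_power: "lb (f ^ n) k = of_nat n * lb f k"
proof (cases "f = 0")
  case True
  then show ?thesis by (cases n) simp_all
next
  case False
  then show ?thesis by (induction n) (simp_all add: lb_mult algebra_simps)
qed

lemma lb_powi: "lb (f powi n) k = of_int n * lb f k"
  by (cases n rule: int_cases2) (simp_all add: lb_power power_int_minus lb_inverse)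

lemma lb_prod:
  "(\<And>i. i \<in> A \<Longrightarrow> f i \<noteq> 0) \<Longrightarrow> lb (prod f A) k = (\<Sum>i\<in>A. lb (f i) k)"
  by (induction A rule: infinite_finite_induct) (simp_all add: lb_mult)

text \<open>Taking logarithmic brackets turns the power into the factor \<open>d\<close>, and the
  Casimir \<open>c\<close> contributes nothing; characteristic zero allows division by
  \<open>d\<close>.\<close>

lemma lb_root:
  assumes "u ^ d = c * t ^ r" "\<And>g. br c g = 0" "t \<noteq> 0" "u \<noteq> 0" "d \<noteq> 0"
  shows "lb u x = of_nat r / of_nat d * lb t x"
proof -
  have "c \<noteq> 0" using assms by auto
  have "of_nat d * lb u x = lb (c * t ^ r) x" by (simp add: lb_power flip: assms(1))
  also have "\<dots> = of_nat r * lb t x"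
    using \<open>c \<noteq> 0\<close> assms(2,3) by (simp add: lb_mult lb_power) (simp add: lb_def)
  finally show ?thesis using assms(5) by (simp add: field_simps)
qed

text \<open>By \<open>lb_root\<close> each summand satisfies
  \<open>br (u r) x = (r / d) * u r * (lb t x * x)\<close>, and the last factor can be pulled out of
  the sum. The witness is the mean of the numbers \<open>r / d\<close> with weights
  \<open>u r\<close>: an element of the field that does not depend on \<open>x\<close>.\<close>

lemma lb_sum_roots:
  assumes "\<And>r. r \<le> d \<Longrightarrow> u r ^ d = c r * t ^ r" "\<And>r g. r \<le> d \<Longrightarrow> br (c r) g = 0"
    and "t \<noteq> 0" "d \<noteq> 0"
  shows "\<exists>\<epsilon>. \<forall>x. lb (\<Sum>r\<le>d. u r) x = \<epsilon> * lb t x"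
proof (intro exI allI)
  fix x
  let ?U = "\<Sum>r\<le>d. u r"
  have "br (u r) x = of_nat r / of_nat d * u r * (lb t x * x)" if "r \<le> d" for r
    using lb_root[of "u r" d "c r" t r x] assms that
    by (cases "u r = 0") (auto simp: br_eq_lb)
  then have "br ?U x = (\<Sum>r\<le>d. of_nat r / of_nat d * u r * (lb t x * x))"
    by (simp add: br_sum)
  also have "\<dots> = (\<Sum>r\<le>d. of_nat r / of_nat d * u r) * (lb t x * x)"
    by (simp add: sum_distrib_right)
  finally show "lb ?U x = (\<Sum>r\<le>d. of_nat r / of_nat d * u r) / ?U * lb t x"
    by (cases "x = 0") (simp_all add: lb_def)
qed

end


section \<open>Mutation of exchange data\<close>

definition laurent_monomial :: "('i::finite \<Rightarrow> 'a::field) \<Rightarrow> ('i \<Rightarrow> int) \<Rightarrow> 'a" where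
  "laurent_monomial f e = (\<Prod>l\<in>UNIV. f l powi e l)"

lemma laurent_monomial_cong: "(\<And>l. e l = e' l) \<Longrightarrow> laurent_monomial f e = laurent_monomial f e'"
  by (simp add: laurent_monomial_def)

lemma laurent_monomial_neq_0: "(\<And>l. f l \<noteq> 0) \<Longrightarrow> laurent_monomial f e \<noteq> 0"
  by (simp add: laurent_monomial_def)

lemma laurent_monomial_add:
  "(\<And>l. f l \<noteq> 0) \<Longrightarrow>
    laurent_monomial f (\<lambda>l. e l + e' l) = laurent_monomial f e * laurent_monomial f e'"
  by (simp add: laurent_monomial_def power_int_add prod.distrib)

lemma laurent_monomial_minus: "laurent_monomial f (\<lambda>l. - e l) = inverse (laurent_monomial f e)"
  by (simp add: laurent_monomial_def power_int_minus prod_inversef[symmetric] o_def)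

lemma laurent_monomial_power:
  "laurent_monomial f e ^ n = laurent_monomial f (\<lambda>l. int n * e l)"
  by (simp add: laurent_monomial_def power_int_power' mult.commute prod_power_distrib)

text \<open>The exponent \<open>c\<close> is free: \<open>f m\<close> is reinserted with exponent
  \<open>c\<close> and compensated outside, so that the remaining monomial can be given a convenient
  form.\<close>

lemma laurent_monomial_upd:
  assumes "f m \<noteq> 0"
  shows "laurent_monomial (f(m := x)) e = x powi e m * f m powi (- c) * laurent_monomial f (e(m := c))"
proof -
  have "laurent_monomial (f(m := x)) e = x powi e m * (\<Prod>l\<in>UNIV - {m}. f l powi e l)"
    unfolding laurent_monomial_def by (subst prod.remove[of _ m]) auto
  moreover have "laurent_monomial f (e(m := c)) = f m powi c * (\<Prod>l\<in>UNIV - {m}. f l powi e l)"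
    unfolding laurent_monomial_def by (subst prod.remove[of _ m]) auto
  moreover have "f m powi (- c) * f m powi c = 1"
    using assms by (simp add: power_int_minus)
  ultimately show ?thesis by (simp add: mult.assoc)
qed

section \<open>Quiver mutation in terms of signed arrow numbers\<close>

definition signed_arrows :: "'i quiver \<Rightarrow> 'i \<Rightarrow> 'i \<Rightarrow> int" where
  "signed_arrows Q i j = int (arrows Q i j) - int (arrows Q j i)"

text \<open>The factor by which an arrow at the mutable vertex \<open>m\<close> with other end \<open>l\<close> counts in the
  exponents of \<open>t\<^sub>m\<close>, \<open>T\<^sub>0\<close> and \<open>T\<^sub>d\<close>.\<close>

definition weight :: "'i quiver \<Rightarrow> 'i \<Rightarrow> 'i \<Rightarrow> nat" where
  "weight Q m l = (if l \<in> mutables Q then mults Q m else 1)"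

lemma signed_arrows_self [simp]: "signed_arrows Q i i = 0"
  by (simp add: signed_arrows_def)

lemma quiver_mutation_simps [simp]:
  "verts (quiver_mutation m Q) = verts Q"
  "mutables (quiver_mutation m Q) = mutables Q"
  "mults (quiver_mutation m Q) = mults Q"
  "frozens (quiver_mutation m Q) = frozens Q"
  "weight (quiver_mutation m Q) = weight Q"
  by (simp_all add: quiver_mutation_def Let_def frozens_def weight_def fun_eq_iff)

text \<open>Deleting 2-cycles does not affect the difference of the two arrow numbers, so the
  truncated subtraction disappears.\<close>

lemma signed_arrows_mutation:
  assumes "i \<noteq> m" "j \<noteq> m"
  shows "signed_arrows (quiver_mutation m Q) i j = signed_arrows Q i j
    + (if i \<in> mutables Q \<and> j \<in> mutables Q then int (mults Q m)
       else if i \<in> mutables Q then int (mults Q i)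
       else if j \<in> mutables Q then int (mults Q j) else 0)
      * (int (arrows Q i m) * int (arrows Q m j) - int (arrows Q j m) * int (arrows Q m i))"
proof -
  have *: "int (a - b) - int (b - a) = int a - int b" for a b :: nat by linarith
  show ?thesis
    using assms by (auto simp: signed_arrows_def quiver_mutation_def Let_def * algebra_simps)
qed

lemma signed_arrows_mutation_at [simp]:
  "signed_arrows (quiver_mutation m Q) m j = - signed_arrows Q m j"
  "signed_arrows (quiver_mutation m Q) j m = - signed_arrows Q j m"
  by (auto simp: signed_arrows_def quiver_mutation_def Let_def)

section \<open>Conditions of \<open>seed\<close> that mutation preserves, and normal forms of the
  exchange data\<close>

locale exchange_data =
  fixes S :: "'s::{finite,linorder} seed"
  assumes verts: "verts (quiv S) = UNIV"
    and no_loop [simp]: "sarr S i i = 0"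
    and no_2_cycle: "sarr S i j = 0 \<or> sarr S j i = 0"
    and deg_pos: "m \<in> smut S \<Longrightarrow> sdeg S m > 0"
    and coeffs_ends [simp]: "m \<in> smut S \<Longrightarrow> coeffs S m 0 = 1"
      "m \<in> smut S \<Longrightarrow> coeffs S m (sdeg S m) = 1"

lemma seed_imp_exchange_data: "seed S \<Longrightarrow> exchange_data S"
  by (auto simp: seed_def exchange_data_def Suc_le_eq)

lemma mutate_simps [simp]:
  "quiv (mutate m S) = quiver_mutation m (quiv S)"
  "cluster (mutate m S) = (cluster S)(m := exch_poly S m / cluster S m)"
  "coeffs (mutate m S) = (coeffs S)(m := (\<lambda>r. coeffs S m (sdeg S m - r)))"
  by (simp_all add: mutate_def)

text \<open>For \<open>a = 0\<close> it rests on \<open>(d - r) * b\<close> being congruent to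
  \<open>- r * b\<close> modulo \<open>d\<close>. With opposite arrow numbers as \<open>a\<close>
  and \<open>b\<close>, it makes the exponents in \<open>p_star\<close> depend only on residues of
  signed arrow numbers.\<close>

lemma mod_sum_eq_mod_diff:
  fixes a b r d :: nat
  assumes "a = 0 \<or> b = 0" "r \<le> d"
  shows "int ((r * a) mod d) + int (((d - r) * b) mod d) = (int r * (int a - int b)) mod int d"
proof (cases "b = 0")
  case True
  then show ?thesis by (simp add: zmod_int)
next
  case False
  then have "a = 0" using assms(1) by simp
  have "int ((d - r) * b) = - (int r * int b) + int b * int d"
    using assms(2) by (simp add: of_nat_diff algebra_simps)
  then have "int ((d - r) * b) mod int d = (- (int r * int b)) mod int d"
    by (simp only: mod_mult_self1)
  with \<open>a = 0\<close> show ?thesis by (simp add: zmod_int)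
qed

context exchange_data
begin

lemma exchange_data_mutate: "exchange_data (mutate m S)"
proof
  show "arrows (quiv (mutate m S)) i i = 0" for i
    by (simp add: quiver_mutation_def Let_def)
  show "arrows (quiv (mutate m S)) i j = 0 \<or> arrows (quiv (mutate m S)) j i = 0" for i j
    by (auto simp: quiver_mutation_def Let_def)
qed (use verts deg_pos in auto)

lemma prod_smut_sfroz:
  "(\<Prod>l\<in>smut S. F l) * (\<Prod>l\<in>sfroz S. G l) = (\<Prod>l\<in>UNIV. if l \<in> smut S then F l else G l)"
proof -
  have "(\<Prod>l\<in>UNIV. if l \<in> smut S then F l else G l)
      = prod F (UNIV \<inter> {l. l \<in> smut S}) * prod G (UNIV \<inter> - {l. l \<in> smut S})"
    by (subst prod.If_cases) simp_all
  moreover have "sfroz S = UNIV \<inter> - {l. l \<in> smut S}"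
    using verts by (auto simp: frozens_def)
  ultimately show ?thesis by simp
qed

lemma t_var_eq:
  "t_var S m = laurent_monomial (cluster S) (\<lambda>l. int (weight (quiv S) m l) * signed_arrows (quiv S) m l)"
  unfolding y_variable_def prod_smut_sfroz laurent_monomial_def
  by (intro prod.cong) (simp_all add: weight_def signed_arrows_def)

lemma exch_term_eq:
  "exch_term S m r = coeffs S m r * laurent_monomial (cluster S) (\<lambda>l.
     if l \<in> smut S then int (r * sarr S m l) + int ((sdeg S m - r) * sarr S l m)
     else int ((r * sarr S m l) div sdeg S m) + int (((sdeg S m - r) * sarr S l m) div sdeg S m))"
proof -
  let ?f = "cluster S" and ?b = "sarr S" and ?d = "sdeg S m"
  have "exch_term S m r = coeffs S m r *
      ((\<Prod>l\<in>smut S. ?f l ^ (r * ?b m l) * ?f l ^ ((?d - r) * ?b l m)) *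
       (\<Prod>l\<in>sfroz S. ?f l ^ ((r * ?b m l) div ?d) * ?f l ^ (((?d - r) * ?b l m) div ?d)))"
    unfolding exch_term_def Let_def prod.distrib by (simp only: mult_ac)
  also have "\<dots> = coeffs S m r * laurent_monomial ?f (\<lambda>l.
     if l \<in> smut S then int (r * sarr S m l) + int ((sdeg S m - r) * sarr S l m)
     else int ((r * sarr S m l) div sdeg S m) + int (((sdeg S m - r) * sarr S l m) div sdeg S m))"
    unfolding prod_smut_sfroz laurent_monomial_def
    by (intro arg_cong2[of _ _ _ _ "(*)"] prod.cong refl)
      (simp flip: power_add of_nat_add of_nat_mult add: power_int_of_nat del: of_nat_add of_nat_mult)
  finally show ?thesis .
qed

text \<open>At \<open>r = 0\<close> and at \<open>r = sdeg S m\<close> the floors are exact and the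
  coefficient is 1, so the two extreme summands are monomials in the cluster.\<close>

lemma exch_term_0:
  assumes "m \<in> smut S"
  shows "exch_term S m 0 = laurent_monomial (cluster S) (\<lambda>l. int (weight (quiv S) m l * sarr S l m))"
  using assms deg_pos[OF assms] unfolding exch_term_eq
  by (auto simp: weight_def intro!: laurent_monomial_cong)

lemma exch_term_top:
  assumes "m \<in> smut S"
  shows "exch_term S m (sdeg S m)
    = laurent_monomial (cluster S) (\<lambda>l. int (weight (quiv S) m l * sarr S m l))"
  using assms deg_pos[OF assms] unfolding exch_term_eq
  by (auto simp: weight_def intro!: laurent_monomial_cong)

lemma p_star_eq:
  assumes "m \<in> smut S" "r \<le> sdeg S m"
  shows "p_star S m r = coeffs S m r ^ sdeg S m *
    (\<Prod>l\<in>sfroz S. cluster S l powi (- ((int r * signed_arrows (quiv S) m l) mod int (sdeg S m))))"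
  unfolding p_star_def Let_def signed_arrows_def
    mod_sum_eq_mod_diff[OF no_2_cycle assms(2), symmetric] by simp

text \<open>Keeps the two remainders separate, to match the two floors in
  \<open>exch_term_eq\<close>; the merged form \<open>p_star_eq\<close> serves for mutation.\<close>

lemma p_star_eq_laurent:
  "p_star S m r = coeffs S m r ^ sdeg S m * laurent_monomial (cluster S) (\<lambda>l. if l \<in> smut S then 0
     else - int ((r * sarr S m l) mod sdeg S m) - int (((sdeg S m - r) * sarr S l m) mod sdeg S m))"
  (is "_ = _ * laurent_monomial _ (\<lambda>l. if _ then 0 else ?e l)")
proof -
  have "(\<Prod>l\<in>sfroz S. cluster S l powi ?e l) = (\<Prod>l\<in>smut S. 1) * (\<Prod>l\<in>sfroz S. cluster S l powi ?e l)"
    by simp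
  also have "\<dots> = laurent_monomial (cluster S) (\<lambda>l. if l \<in> smut S then 0 else ?e l)"
    unfolding prod_smut_sfroz laurent_monomial_def by (intro prod.cong) simp_all
  finally show ?thesis by (simp add: p_star_def Let_def)
qed

end

lemma exchange_data_seeds: "S \<in> seeds S0 \<Longrightarrow> exchange_data S0 \<Longrightarrow> exchange_data S"
  by (induction rule: seeds.induct) (simp_all add: exchange_data.exchange_data_mutate)

section \<open>Exchange ratios, and mutation of \<open>t_var\<close> and
  \<open>p_star\<close>\<close>

locale nonzero_cluster = exchange_data +
  assumes cluster_neq_0: "\<And>l. cluster S l \<noteq> 0"
begin

lemma t_var_neq_0: "t_var S m \<noteq> 0"
  unfolding t_var_eq by (intro laurent_monomial_neq_0 cluster_neq_0)

lemma exch_term_0_neq_0: "m \<in> smut S \<Longrightarrow> exch_term S m 0 \<noteq> 0"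
  by (simp add: exch_term_0 laurent_monomial_neq_0 cluster_neq_0)

lemma exch_term_top_neq_0: "m \<in> smut S \<Longrightarrow> exch_term S m (sdeg S m) \<noteq> 0"
  by (simp add: exch_term_top laurent_monomial_neq_0 cluster_neq_0)

lemma exch_ratio_power:
  assumes "m \<in> smut S" "r \<le> sdeg S m"
  shows "(exch_term S m r / exch_term S m 0) ^ sdeg S m = p_star S m r * t_var S m ^ r"
proof -
  let ?d = "sdeg S m" and ?L = "laurent_monomial (cluster S)"
  let ?e = "\<lambda>l. if l \<in> smut S then int (r * sarr S m l) + int ((?d - r) * sarr S l m)
     else int ((r * sarr S m l) div ?d) + int (((?d - r) * sarr S l m) div ?d)"
  let ?z = "\<lambda>l. int (weight (quiv S) m l * sarr S l m)"
  let ?p = "\<lambda>l. if l \<in> smut S then 0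
     else - int ((r * sarr S m l) mod ?d) - int (((?d - r) * sarr S l m) mod ?d)"
  let ?t = "\<lambda>l. int (weight (quiv S) m l) * signed_arrows (quiv S) m l"
  have L: "?L (\<lambda>l. ?e l + - ?z l) = ?L ?e * inverse (?L ?z)"
    unfolding laurent_monomial_minus[symmetric] by (rule laurent_monomial_add[OF cluster_neq_0])
  have "(exch_term S m r / exch_term S m 0) ^ ?d
      = coeffs S m r ^ ?d * (?L (\<lambda>l. ?e l + - ?z l)) ^ ?d"
    unfolding exch_term_0[OF assms(1)] unfolding exch_term_eq L
    by (simp only: divide_inverse power_mult_distrib mult.assoc)
  also have "(?L (\<lambda>l. ?e l + - ?z l)) ^ ?d = ?L (\<lambda>l. ?p l + int r * ?t l)"
    unfolding laurent_monomial_power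
  proof (rule laurent_monomial_cong)
    fix l
    have div: "int ?d * int (x div ?d) = int x - int (x mod ?d)" for x
      by (metis add_diff_cancel_right' mult_div_mod_eq of_nat_add of_nat_mult)
    show "int ?d * (?e l + - ?z l) = ?p l + int r * ?t l"
      using assms(2)
      by (simp only: distrib_left div weight_def signed_arrows_def split: if_splits)
        (auto simp: distrib_left div of_nat_diff algebra_simps)
  qed
  also have "\<dots> = ?L ?p * t_var S m ^ r"
    by (simp only: laurent_monomial_add[OF cluster_neq_0] t_var_eq laurent_monomial_power)
  finally show ?thesis by (simp only: p_star_eq_laurent mult.assoc)
qed

text \<open>All arrows at \<open>m\<close> are reversed, and the replaced variable does not enter
  because its exponent is 0.\<close>

lemma t_var_mutate_same:
  "t_var (mutate m S) m = inverse (t_var S m)"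
proof -
  interpret M: exchange_data "mutate m S"
    by (rule exchange_data_mutate)
  have "t_var (mutate m S) m = laurent_monomial (cluster S)
      ((\<lambda>l. int (weight (quiv S) m l) * - signed_arrows (quiv S) m l)(m := 0))"
    unfolding M.t_var_eq unfolding mutate_simps quiver_mutation_simps signed_arrows_mutation_at
    by (subst laurent_monomial_upd[OF cluster_neq_0, where c = 0]) simp
  also have "\<dots> = laurent_monomial (cluster S)
      (\<lambda>l. - (int (weight (quiv S) m l) * signed_arrows (quiv S) m l))"
    by (rule laurent_monomial_cong) simp
  finally show ?thesis by (simp add: t_var_eq laurent_monomial_minus)
qed

text \<open>The arrows created by paths through \<open>m\<close> change the exponents by multiples
  of those of the two extreme summands at \<open>m\<close>; the new variable contributes the
  matching powers of the exchange polynomial.\<close>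

lemma t_var_mutate_other:
  assumes "m \<in> smut S" "k \<in> smut S" "k \<noteq> m" "exch_poly S m \<noteq> 0"
  shows "t_var (mutate m S) k = t_var S k
    * (exch_poly S m / exch_term S m 0) ^ (sdeg S k * sarr S m k)
    * inverse ((exch_poly S m / exch_term S m (sdeg S m)) ^ (sdeg S k * sarr S k m))"
proof -
  interpret M: exchange_data "mutate m S"
    by (rule exchange_data_mutate)
  let ?L = "laurent_monomial (cluster S)" and ?P = "exch_poly S m" and ?d = "int (sdeg S k)"
  let ?w = "\<lambda>k l. int (weight (quiv S) k l)" and ?s = "signed_arrows (quiv S)"
    and ?s' = "signed_arrows (quiver_mutation m (quiv S))" and ?b = "\<lambda>i j. int (sarr S i j)"
  let ?e = "\<lambda>l. ?w k l * ?s k l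
      + (?d * ?b k m * (?w m l * ?b m l) + - (?d * ?b m k * (?w m l * ?b l m)))"
  \<comment> \<open>The value at \<open>m\<close> is the exponent of the old variable in
    \<open>t_var S k\<close>. With it the outer powers of the new and the old variable have equal
    exponents, and their product is a power of \<open>?P\<close>.\<close>
  have e: "((\<lambda>l. ?w k l * ?s' k l)(m := ?d * ?s k m)) l = ?e l" for l
    using assms(1-3)
    by (auto simp: weight_def signed_arrows_mutation algebra_simps)
  have "t_var (mutate m S) k
      = (?P / cluster S m) powi (- (?d * ?s k m)) * cluster S m powi (- (?d * ?s k m)) * ?L ?e"
    unfolding M.t_var_eq unfolding mutate_simps quiver_mutation_simps
    using assms(1) e
    by (subst laurent_monomial_upd[OF cluster_neq_0, where c = "?d * ?s k m"])
      (simp only: signed_arrows_mutation_at weight_def if_True mult_minus_right cong: laurent_monomial_cong)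
  also have "(?P / cluster S m) powi (- (?d * ?s k m)) * cluster S m powi (- (?d * ?s k m))
      = ?P powi (- (?d * ?s k m))"
    using cluster_neq_0[of m] by (simp flip: power_int_mult_distrib)
  also have "- (?d * ?s k m) = ?d * ?b m k - ?d * ?b k m"
    by (simp add: signed_arrows_def algebra_simps)
  also have "?P powi \<dots> = ?P ^ (sdeg S k * sarr S m k) / ?P ^ (sdeg S k * sarr S k m)"
    using assms(4) by (simp only: power_int_diff simp_thms power_int_of_nat flip: of_nat_mult)
  also have "?L ?e = t_var S k * (exch_term S m (sdeg S m) ^ (sdeg S k * sarr S k m)
      * inverse (exch_term S m 0 ^ (sdeg S k * sarr S m k)))"
    by (simp only: laurent_monomial_add[OF cluster_neq_0] laurent_monomial_minus t_var_eq
        exch_term_top[OF assms(1)] exch_term_0[OF assms(1)] laurent_monomial_power of_nat_mult mult.assoc)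
  finally show ?thesis by (simp add: field_simps del: mutate_simps)
qed

text \<open>Modulo the degree \<open>d\<close>, \<open>r\<close> times the reversed signed arrow
  number is \<open>d - r\<close> times the original one, in step with the reversal of the
  coefficients.\<close>

lemma p_star_mutate_same:
  assumes "m \<in> smut S" "r \<le> sdeg S m"
  shows "p_star (mutate m S) m r = p_star S m (sdeg S m - r)"
proof -
  interpret M: exchange_data "mutate m S"
    by (rule exchange_data_mutate)
  let ?d = "int (sdeg S m)" and ?s = "signed_arrows (quiv S)"
  have "(int r * - ?s m l) mod ?d = (int (sdeg S m - r) * ?s m l) mod ?d" for l
  proof -
    have "int (sdeg S m - r) * ?s m l = int r * - ?s m l + ?s m l * ?d"
      using assms(2) by (simp add: of_nat_diff algebra_simps)
    then show ?thesis by (simp only: mod_mult_self1)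
  qed
  moreover have "m \<notin> sfroz S" using assms(1) by (simp add: frozens_def)
  ultimately show ?thesis using assms
    by (simp add: p_star_eq M.p_star_eq) (rule disjI2, rule prod.cong, auto)
qed

lemma p_star_mutate_other:
  assumes "m \<in> smut S" "k \<in> smut S" "k \<noteq> m" "r \<le> sdeg S k"
  shows "p_star (mutate m S) k r = p_star S k r"
proof -
  interpret M: exchange_data "mutate m S"
    by (rule exchange_data_mutate)
  let ?d = "int (sdeg S k)" and ?s = "signed_arrows (quiv S)"
    and ?s' = "signed_arrows (quiver_mutation m (quiv S))"
  have mod: "(int r * ?s' k l) mod ?d = (int r * ?s k l) mod ?d" and "l \<noteq> m" if "l \<in> sfroz S" for l
  proof -
    have l: "l \<notin> smut S" using that by (simp add: frozens_def)
    then show "l \<noteq> m" using assms(1) by auto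
    then have "int r * ?s' k l = int r * ?s k l
        + (int r * (int (sarr S k m) * int (sarr S m l) - int (sarr S l m) * int (sarr S m k))) * ?d"
      using assms l by (simp add: signed_arrows_mutation algebra_simps)
    then show "(int r * ?s' k l) mod ?d = (int r * ?s k l) mod ?d"
      by (simp only: mod_mult_self1)
  qed
  then show ?thesis using assms
    by (simp add: p_star_eq M.p_star_eq)
qed

end


section \<open>Log-canonical brackets under mutation\<close>

text \<open>\<open>C\<close> stands for the constants that occur in log-canonical brackets; only its additive
  structure matters.\<close>

locale biderivation_constants = biderivation +
  fixes C :: "'a set"
  assumes C_0: "0 \<in> C" and C_add: "a \<in> C \<Longrightarrow> b \<in> C \<Longrightarrow> a + b \<in> C"
    and C_minus: "a \<in> C \<Longrightarrow> - a \<in> C"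
begin

lemma C_of_nat_mult: "a \<in> C \<Longrightarrow> of_nat n * a \<in> C"
  by (induction n) (simp_all add: C_0 C_add algebra_simps)

lemma C_of_int_mult: "a \<in> C \<Longrightarrow> of_int n * a \<in> C"
  by (cases n rule: int_cases2) (simp_all add: C_of_nat_mult C_minus)

lemma C_sum: "(\<And>i. i \<in> A \<Longrightarrow> f i \<in> C) \<Longrightarrow> sum f A \<in> C"
  by (induction A rule: infinite_finite_induct) (simp_all add: C_0 C_add)

lemma C_diff: "a \<in> C \<Longrightarrow> b \<in> C \<Longrightarrow> a - b \<in> C"
  using C_add[of a "- b"] C_minus[of b] by simp

lemma lb_skew_in_C: "lb g f \<in> C \<Longrightarrow> lb f g \<in> C"
  using C_minus[of "lb g f"] lb_skew[of f g] by simp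

text \<open>Translates between pulled back and stripped cluster variables, which differ by monomials
  in the \<open>h j\<close>; it is applied in both directions.\<close>

lemma lb_rescale:
  fixes J :: "'j set" and g :: "'l \<Rightarrow> 'a" and y :: "'j \<Rightarrow> 'a" and e :: "'l \<Rightarrow> 'j \<Rightarrow> int"
  defines "g' \<equiv> \<lambda>l. g l * (\<Prod>j\<in>J. y j powi e l j)"
  assumes J: "finite J" and g: "\<And>l. g l \<noteq> 0" and y: "\<And>j. j \<in> J \<Longrightarrow> y j \<noteq> 0"
    and yy: "\<And>i j. i \<in> J \<Longrightarrow> j \<in> J \<Longrightarrow> lb (y i) (y j) \<in> C"
    and gy: "\<And>l j. j \<in> J \<Longrightarrow> lb (g l) (y j) \<in> C"
    and gg: "\<And>l k. lb (g l) (g k) \<in> C"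
  shows "j \<in> J \<Longrightarrow> lb (g' l) (y j) \<in> C" and "lb (g' l) (g' k) \<in> C"
proof -
  have step: "lb (g' l) x \<in> C" if "lb (g l) x \<in> C" "\<And>j. j \<in> J \<Longrightarrow> lb (y j) x \<in> C" for l x
  proof -
    have "lb (g' l) x = lb (g l) x + (\<Sum>j\<in>J. of_int (e l j) * lb (y j) x)"
      using J g y unfolding g'_def by (subst lb_mult) (simp_all add: lb_prod lb_powi prod_zero_iff)
    with that show ?thesis by (auto intro!: C_add C_sum C_of_int_mult)
  qed
  show g'y: "lb (g' l) (y j) \<in> C" if "j \<in> J" for l j
    using that gy yy by (intro step) auto
  have "lb (g' l) (g k) \<in> C" for l k
    using gg gy by (intro step) (auto intro: lb_skew_in_C)
  then show "lb (g' l) (g' k) \<in> C"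
    using g'y by (intro step lb_skew_in_C[of "g l" "g' k" for l k]) (auto intro: lb_skew_in_C)
qed

end

text \<open>The almost-cluster up to factors from \<open>H\<close>: it consists of the \<open>\<phi> f\<^sub>l\<close> and of the
  additional frozen variables \<open>H\<close>.\<close>

locale log_canonical_seed = biderivation_constants br C + field_hom \<phi> + nonzero_cluster S
  for br :: "'a::field \<Rightarrow> 'a \<Rightarrow> 'a" and C and \<phi> :: "'s::{finite,linorder} ratfun \<Rightarrow> 'a" and S +
  fixes H :: "'a set"
  assumes casimir_p_star: "m \<in> smut S \<Longrightarrow> r \<le> sdeg S m \<Longrightarrow> br (\<phi> (p_star S m r)) g = 0"
    and lb_cluster_t: "m \<in> smut S \<Longrightarrow> l \<noteq> m \<Longrightarrow> lb (\<phi> (cluster S l)) (\<phi> (t_var S m)) = 0"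
    and lb_H_t: "m \<in> smut S \<Longrightarrow> x \<in> H \<Longrightarrow> lb x (\<phi> (t_var S m)) = 0"
    and lb_cluster_cluster: "lb (\<phi> (cluster S l)) (\<phi> (cluster S k)) \<in> C"
    and lb_cluster_H: "x \<in> H \<Longrightarrow> lb (\<phi> (cluster S l)) x \<in> C"
begin

lemma lb_laurent_monomial:
  "lb (\<phi> (laurent_monomial (cluster S) e)) x = (\<Sum>l\<in>UNIV. of_int (e l) * lb (\<phi> (cluster S l)) x)"
  by (simp add: laurent_monomial_def hom_prod hom_powi lb_prod lb_powi cluster_neq_0)

text \<open>Every cluster variable other than the one at \<open>k\<close> commutes with
  \<open>t_var S k\<close>, so only its exponent survives.\<close>

lemma lb_laurent_monomial_t:
  assumes "k \<in> smut S"
  shows "lb (\<phi> (laurent_monomial (cluster S) e)) (\<phi> (t_var S k))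
    = of_int (e k) * lb (\<phi> (cluster S k)) (\<phi> (t_var S k))"
proof -
  have "lb (\<phi> (laurent_monomial (cluster S) e)) (\<phi> (t_var S k))
      = (\<Sum>l\<in>UNIV. if l = k then of_int (e l) * lb (\<phi> (cluster S l)) (\<phi> (t_var S k)) else 0)"
    unfolding lb_laurent_monomial by (intro sum.cong) (simp_all add: lb_cluster_t assms)
  then show ?thesis by simp
qed

context
  fixes m assumes m: "m \<in> smut S"
begin

text \<open>\<open>lb_sum_roots\<close> for the summands divided by \<open>exch_term S m 0\<close>.
  The factor \<epsilon> is common to all \<open>x\<close> but is not claimed to lie in
  \<open>C\<close>.\<close>

lemma lb_exch_ratio:
  obtains \<epsilon> where "\<And>x. lb (\<phi> (exch_poly S m / exch_term S m 0)) x = \<epsilon> * lb (\<phi> (t_var S m)) x"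
proof -
  have "\<exists>\<epsilon>. \<forall>x. lb (\<Sum>r\<le>sdeg S m. \<phi> (exch_term S m r / exch_term S m 0)) x
      = \<epsilon> * lb (\<phi> (t_var S m)) x"
  proof (rule lb_sum_roots[where c = "\<lambda>r. \<phi> (p_star S m r)"])
    fix r assume "r \<le> sdeg S m"
    then show "\<phi> (exch_term S m r / exch_term S m 0) ^ sdeg S m = \<phi> (p_star S m r) * \<phi> (t_var S m) ^ r"
      using exch_ratio_power[OF m] by (metis hom_power hom_mult)
  qed (use m deg_pos[OF m] in \<open>simp_all add: casimir_p_star t_var_neq_0\<close>)
  then show ?thesis
    using that by (auto simp: exch_poly_def sum_divide_distrib hom_sum)
qed

lemma lb_exch_term_top:
  "lb (\<phi> (exch_term S m (sdeg S m))) x = lb (\<phi> (exch_term S m 0)) x + lb (\<phi> (t_var S m)) x"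
proof -
  have "lb (\<phi> (exch_term S m (sdeg S m) / exch_term S m 0)) x
      = of_nat (sdeg S m) / of_nat (sdeg S m) * lb (\<phi> (t_var S m)) x"
  proof (rule lb_root[where c = "\<phi> (p_star S m (sdeg S m))"])
    show "\<phi> (exch_term S m (sdeg S m) / exch_term S m 0) ^ sdeg S m
        = \<phi> (p_star S m (sdeg S m)) * \<phi> (t_var S m) ^ sdeg S m"
      using exch_ratio_power[OF m] by (metis hom_power hom_mult order_refl)
  qed (use m deg_pos[OF m] in
      \<open>simp_all add: casimir_p_star t_var_neq_0 exch_term_0_neq_0 exch_term_top_neq_0\<close>)
  then show ?thesis
    using deg_pos[OF m] m
    by (simp add: hom_divide lb_divide exch_term_0_neq_0 exch_term_top_neq_0 algebra_simps)
qed

lemma lb_exch_term_0_in_C: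
  assumes "x \<in> H \<union> range (\<lambda>l. \<phi> (cluster S l))"
  shows "lb (\<phi> (exch_term S m 0)) x \<in> C"
  unfolding exch_term_0[OF m] lb_laurent_monomial
  by (intro C_sum C_of_int_mult) (use assms in \<open>auto simp: lb_cluster_H lb_cluster_cluster\<close>)

lemma log_canonical_seed_mutate:
  assumes nz: "exch_poly S m \<noteq> 0"
  shows "log_canonical_seed br C \<phi> (mutate m S) H"
proof -
  let ?S' = "mutate m S" and ?P = "exch_poly S m" and ?T = "exch_term S m"
    and ?b = "\<lambda>i j. of_nat (sarr S i j) :: 'a" and ?d = "\<lambda>i. of_nat (sdeg S i) :: 'a"
  define t where "t = (\<lambda>i. \<phi> (t_var S i))"
  define f where "f = (\<lambda>i. \<phi> (cluster S i))"
  define \<omega> where "\<omega> = (\<lambda>i. lb (f i) (t i))"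
  obtain \<epsilon> where \<epsilon>: "lb (\<phi> (?P / ?T 0)) x = \<epsilon> * lb (t m) x" for x
    using lb_exch_ratio unfolding t_def by metis
  have P: "lb (\<phi> ?P) x = lb (\<phi> (?T 0)) x + \<epsilon> * lb (t m) x" for x
    using \<epsilon>[of x] nz exch_term_0_neq_0[OF m] by (simp add: hom_divide lb_divide algebra_simps)
  define f' where "f' = \<phi> (?P / cluster S m)"
  have f': "lb f' x = lb (\<phi> (?T 0)) x + \<epsilon> * lb (t m) x - lb (f m) x" for x
    using nz cluster_neq_0[of m] by (simp add: f'_def f_def hom_divide lb_divide P)
  have t_f: "lb (t k) (f l) = 0" if "k \<in> smut S" "l \<noteq> k" for k l
    using lb_cluster_t[OF that] lb_skew[of "t k" "f l"] by (simp add: t_def f_def)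
  have t_H: "lb (t k) x = 0" if "k \<in> smut S" "x \<in> H" for k x
    using lb_H_t[OF that] lb_skew[of "t k" x] by (simp add: t_def)
  have t_t: "lb (t i) (t k) = ?d i * (?b i k - ?b k i) * \<omega> k" if "i \<in> smut S" "k \<in> smut S" for i k
    using lb_laurent_monomial_t[OF that(2)] that
    by (simp add: t_def f_def \<omega>_def t_var_eq[of i] weight_def signed_arrows_def)
  have T0_t: "lb (\<phi> (?T 0)) (t k) = ?d m * ?b k m * \<omega> k" if "k \<in> smut S" for k
    using lb_laurent_monomial_t[OF that] that
    by (simp add: exch_term_0[OF m] t_def f_def \<omega>_def weight_def)
  \<comment> \<open>The term with \<epsilon> vanishes because \<open>t m\<close> commutes with
    \<open>f l\<close>; what remains are brackets with constants in \<open>C\<close>.\<close>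
  have f'_f: "lb f' (f l) \<in> C" if "l \<noteq> m" for l
    using t_f[OF m that] lb_exch_term_0_in_C[of "f l"] lb_cluster_cluster[of m l]
    by (simp add: f' f_def C_diff)
  have f'_H: "lb f' x \<in> C" if "x \<in> H" for x
    using t_H[OF m that] lb_exch_term_0_in_C[of x] lb_cluster_H[OF that, of m] that
    by (simp add: f' f_def C_diff)
  have t'_m: "lb (\<phi> (t_var ?S' m)) x = - lb (t m) x" for x
    by (simp add: t_var_mutate_same hom_inverse lb_inverse t_def del: mutate_simps)
  have t'_k: "lb (\<phi> (t_var ?S' k)) x
      = lb (t k) x + ?d k * (\<epsilon> * (?b m k - ?b k m) + ?b k m) * lb (t m) x"
    if "k \<in> smut S" "k \<noteq> m" for k x
  proof -
    have "lb (\<phi> (t_var ?S' k)) x = lb (t k) x + ?d k * ?b m k * lb (\<phi> (?P / ?T 0)) x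
        - ?d k * ?b k m * lb (\<phi> (?P / ?T (sdeg S m))) x"
      unfolding t_var_mutate_other[OF m that nz]
      using nz exch_term_0_neq_0[OF m] exch_term_top_neq_0[OF m] t_var_neq_0[of k]
      by (simp add: hom_mult hom_inverse hom_power lb_mult lb_inverse lb_power t_def)
    \<comment> \<open>Dividing by the top summand instead of \<open>?T 0\<close> lowers the factor
      by 1, since the two differ by \<open>t m\<close> in logarithmic brackets.\<close>
    moreover have "lb (\<phi> (?P / ?T (sdeg S m))) x = (\<epsilon> - 1) * lb (t m) x"
      using nz exch_term_top_neq_0[OF m]
      by (simp add: hom_divide lb_divide P lb_exch_term_top t_def algebra_simps)
    ultimately show ?thesis by (simp add: \<epsilon> algebra_simps)
  qed
  text \<open>Antisymmetry of \<open>lb (t m) (t k)\<close> determines \<open>\<omega> k / d k\<close> along the arrows.\<close>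
  have \<omega>: "(\<epsilon> * (?b m k - ?b k m) + ?b k m) * (?d k * \<omega> m - ?d m * \<omega> k) = 0" if k: "k \<in> smut S" for k
  proof (cases "sarr S m k = sarr S k m")
    case True
    then have "sarr S m k = 0" "sarr S k m = 0" using no_2_cycle[of m k] by auto
    then show ?thesis by simp
  next
    case False
    have "?d m * (?b m k - ?b k m) * \<omega> k = ?d k * (?b m k - ?b k m) * \<omega> m"
      using lb_skew[of "t m" "t k"] t_t[OF m k] t_t[OF k m] by (simp add: algebra_simps)
    then have "of_int (signed_arrows (quiv S) m k) * (?d k * \<omega> m - ?d m * \<omega> k) = 0"
      by (simp add: signed_arrows_def algebra_simps)
    then have "?d k * \<omega> m - ?d m * \<omega> k = 0"
      using False unfolding mult_eq_0_iff of_int_eq_0_iff by (simp add: signed_arrows_def)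
    then show ?thesis by simp
  qed
  have cl': "\<phi> (cluster ?S' l) = (if l = m then f' else f l)" for l
    by (simp add: f'_def f_def)
  interpret M: exchange_data ?S'
    by (rule exchange_data_mutate)
  show ?thesis
  proof unfold_locales
    show "cluster ?S' l \<noteq> 0" for l
      using nz cluster_neq_0 by simp
  next
    fix k r g
    assume kr: "k \<in> smut ?S'" "r \<le> sdeg ?S' k"
    show "br (\<phi> (p_star ?S' k r)) g = 0"
    proof (cases "k = m")
      case True
      then show ?thesis using kr p_star_mutate_same[OF m] casimir_p_star[OF m]
        by (simp del: mutate_simps(2,3))
    next
      case False
      then show ?thesis using kr p_star_mutate_other[OF m] casimir_p_star by simp
    qed
  next
    fix k l
    assume k: "k \<in> smut ?S'" and l: "l \<noteq> k"
    have "lb (\<phi> (t_var ?S' k)) (\<phi> (cluster ?S' l)) = 0"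
    proof (cases "k = m")
      case True
      then show ?thesis using l t_f[OF m] by (simp add: cl' t'_m del: mutate_simps)
    next
      case False
      have k': "k \<in> smut S" using k by simp
      show ?thesis
      proof (cases "l = m")
        case True
        \<comment> \<open>The brackets of \<open>f'\<close> with \<open>t k\<close> and
          \<open>t m\<close> are computed separately; combined by \<open>t'_k\<close> they give
          exactly the product that \<open>\<omega>\<close> shows to be zero.\<close>
        have "lb (t k) f' = - (lb (\<phi> (?T 0)) (t k) + \<epsilon> * lb (t m) (t k) - lb (f m) (t k))"
          using lb_skew[of "t k" f'] f' by simp
        also have "lb (f m) (t k) = 0"
          using t_f[OF k', of m] False lb_skew[of "f m" "t k"] by simp
        finally have "lb (t k) f' = - ?d m * (\<epsilon> * (?b m k - ?b k m) + ?b k m) * \<omega> k"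
          using t_t[OF m k'] T0_t[OF k'] by (simp add: algebra_simps)
        moreover have "lb (t m) f' = \<omega> m"
          using lb_skew[of "t m" f'] T0_t[OF m] by (simp add: f' \<omega>_def)
        ultimately have "lb (\<phi> (t_var ?S' k)) f'
            = (\<epsilon> * (?b m k - ?b k m) + ?b k m) * (?d k * \<omega> m - ?d m * \<omega> k)"
          unfolding t'_k[OF k' False] by (simp add: algebra_simps)
        then show ?thesis using \<omega>[OF k'] True by (simp add: cl' del: mutate_simps)
      next
        case l_m: False
        then show ?thesis using l t_f[OF k'] t_f[OF m]
          by (simp add: cl' t'_k[OF k' False] del: mutate_simps)
      qed
    qed
    then show "lb (\<phi> (cluster ?S' l)) (\<phi> (t_var ?S' k)) = 0"
      using lb_skew[of "\<phi> (cluster ?S' l)" "\<phi> (t_var ?S' k)"] by simp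
  next
    fix k x
    assume k: "k \<in> smut ?S'" and x: "x \<in> H"
    then have "k \<in> smut S" by simp
    then have "lb (\<phi> (t_var ?S' k)) x = 0"
      using x by (cases "k = m") (simp_all add: t'_m t'_k t_H m del: mutate_simps)
    then show "lb x (\<phi> (t_var ?S' k)) = 0"
      using lb_skew[of x "\<phi> (t_var ?S' k)"] by simp
  next
    fix l k
    have "lb (f l) f' \<in> C" if "l \<noteq> m" for l
      using lb_skew[of "f l" f'] f'_f[OF that] by (simp add: C_minus)
    then show "lb (\<phi> (cluster ?S' l)) (\<phi> (cluster ?S' k)) \<in> C"
      using f'_f[of k] lb_cluster_cluster[of l k] C_0 unfolding cl' by (auto simp: f_def)
  next
    fix x l assume "x \<in> H"
    then show "lb (\<phi> (cluster ?S' l)) x \<in> C"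
      using f'_H lb_cluster_H unfolding cl' by (simp add: f_def)
  qed
qed

end

end


section \<open>The pulled back seed\<close>

lemma prod_powi_sum:
  "(x :: 'a::field) \<noteq> 0 \<Longrightarrow> (\<Prod>l\<in>A. x powi c l) = x powi (\<Sum>l\<in>A. c l)"
  by (induction A rule: infinite_finite_induct) (simp_all add: power_int_add)

lemma prod_powi: "prod f A powi n = (\<Prod>i\<in>A. (f i :: 'a::field) powi n)"
  by (induction A rule: infinite_finite_induct) (simp_all add: power_int_mult_distrib)

lemma poly_fun_eq_0_iff: "poly_fun p = 0 \<longleftrightarrow> p = 0"
  by (simp add: poly_fun_def Zero_fract_def eq_fract)

locale pulled_back_seed = exchange_data S
  for S :: "'s::{finite,linorder} seed" +
  fixes \<Psi> :: "('r::{finite,linorder}, 's) rational_map" and J :: "'j set" and h :: "'j \<Rightarrow> 'r cpoly"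
  assumes dominant: "dominant \<Psi>" and family: "pullback_family \<Psi> J h"
    and indep: "alg_indep (almost_verts J) (almost_cluster \<Psi> J h S)"
begin

sublocale field_hom "pullback \<Psi>"
  by (rule field_hom_pullback[OF dominant])

lemma finite_J: "finite J"
  using family by (simp add: pullback_family_def)

lemma h_neq_0: "j \<in> J \<Longrightarrow> poly_fun (h j) \<noteq> 0"
  using family by (auto simp: pullback_family_def poly_fun_eq_0_iff irreducible_def)

lemma hmonom_neq_0: "hmonom J h e \<noteq> 0"
  using finite_J h_neq_0 by (simp add: prod_zero_iff)

lemma hmonom_add: "hmonom J h (\<lambda>j. e j + e' j) = hmonom J h e * hmonom J h e'"
  using h_neq_0 by (simp add: power_int_add flip: prod.distrib)

text \<open>\<open>stripped\<close> compensates whatever exponents the choice in \<open>hexp\<close>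
  returns.\<close>

lemma pullback_eq_stripped:
  "pullback \<Psi> f = stripped \<Psi> J h f * hmonom J h (\<lambda>j. - hexp \<Psi> J h f j)"
proof -
  have "hmonom J h (hexp \<Psi> J h f) * hmonom J h (\<lambda>j. - hexp \<Psi> J h f j) = 1"
    by (simp flip: hmonom_add)
  then show ?thesis by (simp add: stripped_def mult.assoc)
qed

lemma stripped_neq_0: "stripped \<Psi> J h (cluster S l) \<noteq> 0"
  using alg_indep_neq_0[OF indep, of "Inl l"] by (simp add: almost_cluster_def almost_verts_def)

sublocale nonzero_cluster
proof
  show "cluster S l \<noteq> 0" for l
    using stripped_neq_0[of l] by (auto simp: stripped_def)
qed

text \<open>The sum is the total exponent of \<open>h j\<close> picked up when each variable in
  \<open>t_var S m\<close> is replaced by its stripped pullback; \<open>delta\<close> is its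
  negative.\<close>

lemma delta_eq:
  assumes "m \<in> smut S"
  shows "delta \<Psi> J h S j m = - (\<Sum>l\<in>UNIV. hexp \<Psi> J h (cluster S l) j
    * (int (weight (quiv S) m l) * signed_arrows (quiv S) m l))"
proof -
  let ?F = "\<lambda>l. hexp \<Psi> J h (cluster S l) j * (int (weight (quiv S) m l) * signed_arrows (quiv S) m l)"
  have "sum ?F UNIV = sum ?F (smut S \<union> sfroz S)"
    using verts by (intro sum.cong) (auto simp: frozens_def)
  also have "\<dots> = sum ?F (smut S) + sum ?F (sfroz S)"
    by (rule sum.union_disjoint) (auto simp: frozens_def)
  also have "sum ?F (smut S) = - (\<Sum>l\<in>smut S. int (sdeg S m)
      * (int (sarr S l m) - int (sarr S m l)) * hexp \<Psi> J h (cluster S l) j)"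
    unfolding sum_negf[symmetric]
    by (intro sum.cong) (simp_all add: weight_def signed_arrows_def algebra_simps)
  also have "sum ?F (sfroz S)
      = - (\<Sum>l\<in>sfroz S. (int (sarr S l m) - int (sarr S m l)) * hexp \<Psi> J h (cluster S l) j)"
    unfolding sum_negf[symmetric]
    by (intro sum.cong) (simp_all add: weight_def signed_arrows_def frozens_def algebra_simps)
  finally show ?thesis by (simp add: delta_def)
qed

lemma almost_t_var_eq:
  assumes m: "m \<in> smut S"
  shows "almost_t_var (pullback_seed \<Psi> J h S) m = pullback \<Psi> (t_var S m)"
proof -
  let ?a = "\<lambda>l. int (weight (quiv S) m l) * signed_arrows (quiv S) m l"
    and ?f = "\<lambda>l. pullback \<Psi> (cluster S l)" and ?g = "\<lambda>l. stripped \<Psi> J h (cluster S l)"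
    and ?e = "\<lambda>l. hexp \<Psi> J h (cluster S l)" and ?Q = "pullback_quiver \<Psi> J h S"
  have frozens: "frozens ?Q = Inl ` sfroz S \<union> Inr ` J"
    using verts by (auto simp: frozens_def pullback_quiver_def almost_verts_def)
  have disj: "Inl ` sfroz S \<inter> Inr ` J = {}" by auto
  \<comment> \<open>The arrow numbers \<open>nat\<close> of \<open>delta\<close> and of its negative
    differ by \<open>delta\<close>, which is therefore the exponent of \<open>h j\<close>.\<close>
  have "almost_t_var (pullback_seed \<Psi> J h S) m
      = (\<Prod>l\<in>smut S. ?g l powi ?a l) * ((\<Prod>l\<in>sfroz S. ?g l powi ?a l)
        * hmonom J h (\<lambda>j. delta \<Psi> J h S j m))"
    unfolding almost_t_var_def pullback_seed_def almost_seed.simps y_variable_def frozens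
    using m finite_J
    by (subst prod.union_disjoint)
      (auto simp: pullback_quiver_def almost_cluster_def prod.reindex weight_def signed_arrows_def
        frozens_def intro!: arg_cong2[of _ _ _ _ "(*)"] prod.cong arg_cong[of _ _ "power_int _"])
  also have "\<dots> = (\<Prod>l\<in>UNIV. ?g l powi ?a l) * hmonom J h (\<lambda>j. delta \<Psi> J h S j m)"
    using prod_smut_sfroz[of "\<lambda>l. ?g l powi ?a l" "\<lambda>l. ?g l powi ?a l"] by (simp flip: mult.assoc)
  also have "(\<Prod>l\<in>UNIV. ?g l powi ?a l) = (\<Prod>l\<in>UNIV. ?f l powi ?a l * hmonom J h (\<lambda>j. ?e l j * ?a l))"
    by (simp only: stripped_def power_int_mult_distrib prod_powi flip: power_int_mult)
  \<comment> \<open>Interchanging the two products collects the powers of each \<open>h j\<close>;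
    by \<open>delta_eq\<close> the last factor cancels them.\<close>
  also have "\<dots> = pullback \<Psi> (t_var S m) * hmonom J h (\<lambda>j. \<Sum>l\<in>UNIV. ?e l j * ?a l)"
    unfolding prod.distrib t_var_eq laurent_monomial_def
    by (subst prod.swap) (simp add: hom_prod hom_powi prod_powi_sum h_neq_0)
  also have "\<dots> * hmonom J h (\<lambda>j. delta \<Psi> J h S j m) = pullback \<Psi> (t_var S m)"
    by (simp add: delta_eq[OF m] mult.assoc flip: hmonom_add)
  finally show ?thesis .
qed

text \<open>The exponents of the stripped summand cancel; the remaining monomial does not depend on
  \<open>r\<close> and drops out of the ratios in \<open>almost_p_star\<close>.\<close>

lemma almost_exch_term_eq:
  "almost_exch_term \<Psi> J h S m r = pullback \<Psi> (exch_term S m r) * hmonom J h (denom_exp \<Psi> J h S m)"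
  unfolding almost_exch_term_def stripped_def mult.assoc hmonom_add[symmetric] by simp

lemma almost_p_star_eq:
  assumes m: "m \<in> smut S" and r: "r \<le> sdeg S m"
  shows "almost_p_star (pullback_seed \<Psi> J h S) m r = pullback \<Psi> (p_star S m r)"
proof -
  have "almost_p_star (pullback_seed \<Psi> J h S) m r
      = (pullback \<Psi> (exch_term S m r) / pullback \<Psi> (exch_term S m 0)) ^ sdeg S m
        / pullback \<Psi> (t_var S m) ^ r"
    unfolding almost_p_star_def almost_t_var_eq[OF m]
    using hmonom_neq_0 by (simp add: pullback_seed_def pullback_quiver_def almost_exch_term_eq)
  also have "\<dots> = pullback \<Psi> ((exch_term S m r / exch_term S m 0) ^ sdeg S m / t_var S m ^ r)"
    by (simp only: hom_divide hom_power)
  also have "\<dots> = pullback \<Psi> (p_star S m r)"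
    unfolding exch_ratio_power[OF m r] using t_var_neq_0 by simp
  finally show ?thesis .
qed

end

section \<open>From the Poisson hypotheses to compatibility in all seeds\<close>

lemma poisson_imp_biderivation_constants:
  fixes br :: "'v::linorder ratfun \<Rightarrow> 'v ratfun \<Rightarrow> 'v ratfun"
  assumes "poisson_bracket br"
  shows "biderivation_constants br (range const)"
proof
  note br = assms[unfolded poisson_bracket_def]
  show "br (f + g) k = br f k + br g k" for f g k using br by blast
  show "br f g = - br g f" for f g using br by blast
  show "br (f * g) k = f * br g k + g * br f k" for f g k using br by blast
  show "n = 0" if "of_nat n = (0 :: 'v ratfun)" for n using that by (simp add: fract_of_nat_eq_0_iff)
  show "0 \<in> range const" using const.hom_0 by (metis rangeI)
  show "a + b \<in> range const" if "a \<in> range const" "b \<in> range const" for a b :: "'v ratfun"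
    using that by (auto simp flip: const.hom_add)
  show "- a \<in> range const" if "a \<in> range const" for a :: "'v ratfun"
    using that by (auto simp flip: const_minus)
qed

theorem theorem5p2:
  fixes S0 :: "'s::{finite,linorder} seed"
    and br :: "'s ratfun \<Rightarrow> 's ratfun \<Rightarrow> 's ratfun"
    and br_p :: "'r::{finite,linorder} ratfun \<Rightarrow> 'r ratfun \<Rightarrow> 'r ratfun"
    and \<Psi> :: "('r, 's) rational_map"
    and J :: "'j set"
    and h :: "'j \<Rightarrow> 'r cpoly"
  assumes "seed S0" and "regular_structure S0"
    and "poisson_bracket br"
    and "\<forall>m\<in>smut S0. \<forall>r\<le>sdeg S0 m. casimir br (p_star S0 m r)"
    and "\<forall>m\<in>smut S0. \<exists>\<omega>. \<omega> \<noteq> 0 \<and>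
           br (cluster S0 m) (t_var S0 m) = const \<omega> * cluster S0 m * t_var S0 m"
    and "\<forall>m\<in>smut S0. \<forall>l. l \<noteq> m \<longrightarrow> br (cluster S0 l) (t_var S0 m) = 0"
    and "dominant \<Psi>" and "pullback_family \<Psi> J h"
    and "coherent_pullback_exists \<Psi> J h S0"
    and "poisson_bracket br_p" and "poisson_map br_p br \<Psi>"
    and "\<forall>m\<in>smut S0. \<forall>r\<le>sdeg S0 m. casimir br_p (almost_p_star (pullback_seed \<Psi> J h S0) m r)"
    and "\<forall>j\<in>J. \<forall>m\<in>smut S0. br_p (poly_fun (h j)) (almost_t_var (pullback_seed \<Psi> J h S0) m) = 0"
    and "log_canonical_basis br_p (verts (aquiv (pullback_seed \<Psi> J h S0))) (aclus (pullback_seed \<Psi> J h S0))"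
  shows "compatible br_p (pullback_structure \<Psi> J h S0)"
proof -
  let ?\<phi> = "pullback \<Psi>" and ?y = "\<lambda>j. poly_fun (h j)"
  let ?H = "?y ` J" and ?g = "\<lambda>S l. stripped \<Psi> J h (cluster S l)"
  interpret biderivation_constants br_p "range const"
    by (rule poisson_imp_biderivation_constants[OF assms(10)])
  \<comment> \<open>Coherence supplies the algebraic independence of each almost-cluster, hence
    nonzero cluster variables in every seed.\<close>
  have pbs: "pulled_back_seed S \<Psi> J h" if "S \<in> seeds S0" for S
  proof -
    interpret exchange_data S
      using that assms(1) by (intro exchange_data_seeds[OF that] seed_imp_exchange_data)
    show ?thesis
      by unfold_locales (use that assms(7-9) in \<open>auto simp: coherent_pullback_exists_def\<close>)
  qed
  interpret S0: pulled_back_seed S0 \<Psi> J h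
    by (rule pbs[OF seeds.initial])
  have lb_const: "lb f g \<in> range const" if "br_p f g = const \<omega> * f * g" for f g \<omega>
  proof (cases "f = 0 \<or> g = 0")
    case True
    then show ?thesis using C_0 by auto
  next
    case False
    with that show ?thesis by (simp add: lb_def)
  qed
  have S0_lb: "lb (almost_cluster \<Psi> J h S0 i) (almost_cluster \<Psi> J h S0 k) \<in> range const"
    if "i \<in> almost_verts J" "k \<in> almost_verts J" for i k
    using assms(14) that lb_const
    by (fastforce simp: log_canonical_basis_def log_canonical_def pullback_seed_def pullback_quiver_def)
  have yy: "lb (?y i) (?y j) \<in> range const" if "i \<in> J" "j \<in> J" for i j
    using S0_lb[of "Inr i" "Inr j"] that by (simp add: almost_cluster_def almost_verts_def)
  have gy: "lb (?g S0 l) (?y j) \<in> range const" if "j \<in> J" for l j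
    using S0_lb[of "Inl l" "Inr j"] that by (simp add: almost_cluster_def almost_verts_def)
  have gg: "lb (?g S0 l) (?g S0 k) \<in> range const" for l k
    using S0_lb[of "Inl l" "Inl k"] by (simp add: almost_cluster_def almost_verts_def)
  \<comment> \<open>The Casimirs and the relations with the \<open>h j\<close> are transported by
    \<open>almost_p_star_eq\<close> and \<open>almost_t_var_eq\<close>, the vanishing brackets of
    cluster variables with \<open>t_var\<close> by the Poisson map, and the constants by
    rescaling.\<close>
  have lcs_S0: "log_canonical_seed br_p (range const) ?\<phi> S0 ?H"
  proof unfold_locales
    fix m r g assume "m \<in> smut S0" "r \<le> sdeg S0 m"
    then show "br_p (?\<phi> (p_star S0 m r)) g = 0"
      using assms(12) by (simp add: casimir_def flip: S0.almost_p_star_eq)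
  next
    fix m l assume "m \<in> smut S0" "l \<noteq> m"
    then have "br_p (?\<phi> (cluster S0 l)) (?\<phi> (t_var S0 m)) = 0"
      using assms(6,11) by (metis poisson_map_def S0.hom_0)
    then show "lb (?\<phi> (cluster S0 l)) (?\<phi> (t_var S0 m)) = 0" by (simp add: lb_def)
  next
    fix m x assume "m \<in> smut S0" "x \<in> ?H"
    then show "lb x (?\<phi> (t_var S0 m)) = 0"
      using assms(13) by (auto simp: lb_def simp flip: S0.almost_t_var_eq)
  next
    show "lb (?\<phi> (cluster S0 l)) (?\<phi> (cluster S0 k)) \<in> range const" for l k
      unfolding S0.pullback_eq_stripped
      by (rule lb_rescale(2)) (simp_all add: S0.stripped_neq_0 S0.finite_J S0.h_neq_0 yy gy gg)
    show "lb (?\<phi> (cluster S0 l)) x \<in> range const" if "x \<in> ?H" for l x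
      using that unfolding S0.pullback_eq_stripped
      by (auto intro!: lb_rescale(1)[where g = "?g S0"] simp: S0.stripped_neq_0 S0.finite_J S0.h_neq_0 yy gy gg)
  qed
  have lcs: "log_canonical_seed br_p (range const) ?\<phi> S ?H" if "S \<in> seeds S0" for S
    using that
  proof (induction rule: seeds.induct)
    case initial
    show ?case by (fact lcs_S0)
  next
    case (adjacent S m)
    interpret log_canonical_seed br_p "range const" ?\<phi> S ?H
      using adjacent by simp
    interpret M: pulled_back_seed "mutate m S" \<Psi> J h
      using adjacent by (intro pbs seeds.adjacent)
    \<comment> \<open>The variable at \<open>m\<close> in the adjacent seed is a nonzero quotient
      with this numerator.\<close>
    have "exch_poly S m \<noteq> 0"
      using M.cluster_neq_0[of m] by auto
    then show ?case by (rule log_canonical_seed_mutate[OF adjacent(2)])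
  qed
  show ?thesis unfolding compatible_def pullback_structure_def
  proof (intro ballI, elim imageE, simp)
    fix S assume S: "S \<in> seeds S0"
    interpret log_canonical_seed br_p "range const" ?\<phi> S ?H by (rule lcs[OF S])
    interpret pulled_back_seed S \<Psi> J h by (rule pbs[OF S])
    \<comment> \<open>The induction concerned pulled back variables; rescaling by the
      \<open>h j\<close> now returns to the members of the almost-cluster.\<close>
    have gg: "lb (?g S l) (?g S k) \<in> range const" for l k
      unfolding stripped_def
      by (rule lb_rescale(2)) (simp_all add: cluster_neq_0 finite_J h_neq_0 yy lb_cluster_H lb_cluster_cluster)
    have gy: "lb (?g S l) (?y j) \<in> range const" if "j \<in> J" for l j
      unfolding stripped_def using that
      by (auto intro!: lb_rescale(1)[where g = "\<lambda>l. ?\<phi> (cluster S l)"] simp: cluster_neq_0 finite_J h_neq_0 yy lb_cluster_H lb_cluster_cluster)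
    have "lb (almost_cluster \<Psi> J h S i) (almost_cluster \<Psi> J h S k) \<in> range const"
      if "i \<in> almost_verts J" "k \<in> almost_verts J" for i k
      using that gg gy yy lb_skew_in_C[OF gy]
      by (auto simp: almost_verts_def almost_cluster_def)
    then show "log_canonical br_p (verts (aquiv (pullback_seed \<Psi> J h S))) (aclus (pullback_seed \<Psi> J h S))"
      unfolding log_canonical_def pullback_seed_def pullback_quiver_def
      by (auto simp: br_eq_lb)
  qed
qed

end
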